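(* Let $(\mathcal{A},\tau)$ be a non-commutative probability space, where $\mathcal{A}$ is a unital $C^*$-algebra and $\tau$ is a positive, faithful, tracial linear functional with $\tau(1_{\mathcal{A}})=1$. Let $x,s\in\mathcal{A}$ be self-adjoint random variables that are free with respect to $\tau$, and suppose that $s$ is semicircular. Then $$\kappa_n(x+i[x,s])=\kappa_n(x)+\sum_{k=1}^{\lfloor n/2\rfloor}\ \sum_{\substack{\sigma\in\mathrm{Int}_{\ge 2}(n)\\ |\sigma|=k,\ 1\in V_1}}\ \sum_{\pi\in NC(k)}|V_1|\,\kappa_{\pi(\sigma)}(x),$$ where, for each $\sigma$ in the sum, $V_1$ denotes the block of $\sigma$ containing $1$.
   Context: Here $n\ge 1$ is an integer, $[a,b]=ab-ba$ and $i$ is the imaginary unit. $\kappa_n(a)=\kappa_n(a,\dots,a)$ denotes the $n$-th free cumulant of $a$ with respect to $\tau$, and for a non-crossing partition $\rho$ of $\{1,\dots,n\}$, $\kappa_\rho(x)=\prod_{Z\in\rho}\kappa_{|Z|}(x)$, the product being over the blocks $Z$ of $\rho$. An element $s$ is semicircular if it is self-adjoint and its only non-vanishing free cumulant is $\kappa_2(s)>0$. $\mathrm{Int}_{\ge 2}(n)$ is the set of interval partitions of $\{1,\dots,n\}$ (partitions all of whose blocks consist of consecutive integers) in which every block has at least two elements; $|\sigma|$ is the number of blocks of $\sigma$, and $|V_1|$ is the number of elements of $V_1$. $NC(k)$ is the set of non-crossing partitions of $\{1,\dots,k\}$. For an interval partition $\sigma=\{W_1,\dots,W_k\}$ of $\{1,\dots,n\}$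 with blocks listed in increasing order, and $\pi=\{U_1,\dots,U_m\}\in NC(k)$, $\pi(\sigma)$ denotes the non-crossing partition $\{Z_1,\dots,Z_m\}$ of $\{1,\dots,n\}$ with $Z_j=\bigcup_{l\in U_j}W_l$ for $j=1,\dots,m$.
   Formalization: The semicircular element s is additionally assumed normalized, κ_2(s)=1; for any other variance the stated formula already fails at n=2 whenever x is not a scalar, since κ_2(x+i[x,s])=κ_2(x)+2κ_2(s)κ_2(x). *)

theory Defs
  imports "HOL-Analysis.Analysis" "HOL-Library.Disjoint_Sets"
begin

section \<open>Unital \<open>C\<^sup>*\<close>-algebras and tracial states\<close>

text \<open>The superclasses provide the real unital Banach algebra; this class adds the complex structure
  (which extends the real one) and the involution. The zero algebra is excluded by \<open>norm 1 = 1\<close>.\<close>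

class unital_cstar_algebra = real_normed_algebra_1 + complete_space +
  fixes scaleC :: "complex \<Rightarrow> 'a \<Rightarrow> 'a"  (infixr "*\<^sub>C" 75)
    and adj :: "'a \<Rightarrow> 'a"
  assumes scaleC_add_right: "c *\<^sub>C (x + y) = c *\<^sub>C x + c *\<^sub>C y"
    and scaleC_add_left: "(c + d) *\<^sub>C x = c *\<^sub>C x + d *\<^sub>C x"
    and scaleC_scaleC: "c *\<^sub>C (d *\<^sub>C x) = (c * d) *\<^sub>C x"
    and scaleR_scaleC: "scaleR r x = complex_of_real r *\<^sub>C x"
    and mult_scaleC_left: "(c *\<^sub>C x) * y = c *\<^sub>C (x * y)"
    and mult_scaleC_right: "x * (c *\<^sub>C y) = c *\<^sub>C (x * y)"
    and norm_scaleC: "norm (c *\<^sub>C x) = cmod c * norm x"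
    and adj_add: "adj (x + y) = adj x + adj y"
    and adj_scaleC: "adj (c *\<^sub>C x) = cnj c *\<^sub>C adj x"
    and adj_mult: "adj (x * y) = adj y * adj x"
    and adj_adj: "adj (adj x) = x"
    and cstar_identity: "norm (adj x * x) = (norm x)\<^sup>2"

definition self_adjoint :: "'a::unital_cstar_algebra \<Rightarrow> bool" where
  "self_adjoint a \<longleftrightarrow> adj a = a"

locale faithful_tracial_state =
  fixes \<tau> :: "'a::unital_cstar_algebra \<Rightarrow> complex"
  assumes add: "\<tau> (a + b) = \<tau> a + \<tau> b"
    and scaleC: "\<tau> (c *\<^sub>C a) = c * \<tau> a"
    and unital: "\<tau> 1 = 1"
    and positive: "\<tau> (adj a * a) \<in> \<real>" "0 \<le> Re (\<tau> (adj a * a))"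
    and faithful: "\<tau> (adj a * a) = 0 \<Longrightarrow> a = 0"
    and tracial: "\<tau> (a * b) = \<tau> (b * a)"

section \<open>Freeness\<close>

inductive_set unital_subalgebra_gen :: "'a::unital_cstar_algebra set \<Rightarrow> 'a set" for S where
  gen: "a \<in> S \<Longrightarrow> a \<in> unital_subalgebra_gen S"
| one: "1 \<in> unital_subalgebra_gen S"
| scaleC: "a \<in> unital_subalgebra_gen S \<Longrightarrow> c *\<^sub>C a \<in> unital_subalgebra_gen S"
| add: "a \<in> unital_subalgebra_gen S \<Longrightarrow> b \<in> unital_subalgebra_gen S
    \<Longrightarrow> a + b \<in> unital_subalgebra_gen S"
| mult: "a \<in> unital_subalgebra_gen S \<Longrightarrow> b \<in> unital_subalgebra_gen S
    \<Longrightarrow> a * b \<in> unital_subalgebra_gen S"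

text \<open>A list of pairs \<open>(i\<^sub>j, a\<^sub>j)\<close> encodes a product of elements \<open>a\<^sub>j \<in> A i\<^sub>j\<close>; \<open>distinct_adj\<close> says that
  neighbouring indices differ.\<close>

definition free_subalgebras ::
    "('a::unital_cstar_algebra \<Rightarrow> complex) \<Rightarrow> 'i set \<Rightarrow> ('i \<Rightarrow> 'a set) \<Rightarrow> bool" where
  "free_subalgebras \<tau> I A \<longleftrightarrow>
    (\<forall>w. w \<noteq> [] \<longrightarrow> (\<forall>(i, a) \<in> set w. i \<in> I \<and> a \<in> A i \<and> \<tau> a = 0) \<longrightarrow>
       distinct_adj (map fst w) \<longrightarrow> \<tau> (prod_list (map snd w)) = 0)"

definition free_pair :: "('a::unital_cstar_algebra \<Rightarrow> complex) \<Rightarrow> 'a \<Rightarrow> 'a \<Rightarrow> bool" where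
  "free_pair \<tau> x y \<longleftrightarrow>
    free_subalgebras \<tau> UNIV (\<lambda>b::bool. unital_subalgebra_gen {if b then x else y})"

section \<open>Partitions\<close>

definition noncrossing :: "nat set set \<Rightarrow> bool" where
  "noncrossing \<pi> \<longleftrightarrow>
    (\<forall>V\<in>\<pi>. \<forall>W\<in>\<pi>. V \<noteq> W \<longrightarrow>
       \<not> (\<exists>a b c d. a < b \<and> b < c \<and> c < d \<and> a \<in> V \<and> b \<in> W \<and> c \<in> V \<and> d \<in> W))"

definition NC :: "nat \<Rightarrow> nat set set set" where
  "NC n = {\<pi>. partition_on {1..n} \<pi> \<and> noncrossing \<pi>}"

definition Int_ge2 :: "nat \<Rightarrow> nat set set set" where
  "Int_ge2 n = {\<sigma>. partition_on {1..n} \<sigma> \<and> (\<forall>V\<in>\<sigma>. (\<exists>a b. V = {a..b}) \<and> 2 \<le> card V)}"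

definition block_of :: "nat set set \<Rightarrow> nat \<Rightarrow> nat set" where
  "block_of \<sigma> j = (THE V. V \<in> \<sigma> \<and> j \<in> V)"

text \<open>The blocks of an interval partition in increasing order, indexed from \<open>1\<close>: the \<open>l\<close>-th block
  is the one containing the \<open>l\<close>-th smallest block minimum.\<close>

definition nth_block :: "nat set set \<Rightarrow> nat \<Rightarrow> nat set" where
  "nth_block \<sigma> l = block_of \<sigma> (sorted_list_of_set (Min ` \<sigma>) ! (l - 1))"

text \<open>The partition written \<open>\<pi>(\<sigma>)\<close>.\<close>

definition inflate :: "nat set set \<Rightarrow> nat set set \<Rightarrow> nat set set" where
  "inflate \<pi> \<sigma> = (\<lambda>U. \<Union>l\<in>U. nth_block \<sigma> l) ` \<pi>"

section \<open>Free cumulants\<close>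

text \<open>For \<open>V = {j\<^sub>1 < \<dots> < j\<^sub>k}\<close>, the list \<open>a\<^bsub>j\<^sub>1\<^esub>, \<dots>, a\<^bsub>j\<^sub>k\<^esub>\<close>; positions are counted from \<open>1\<close>.\<close>

definition entries :: "'a list \<Rightarrow> nat set \<Rightarrow> 'a list" where
  "entries as V = map (\<lambda>j. as ! (j - 1)) (sorted_list_of_set V)"

lemma NC_block_proper:
  assumes "\<pi> \<in> NC n" "\<pi> \<noteq> {{1..n}}" "V \<in> \<pi>"
  shows "card V < n"
proof -
  have p: "partition_on {1..n} \<pi>" using assms(1) by (simp add: NC_def)
  have sub: "V \<subseteq> {1..n}" using p assms(3) by (auto simp: partition_on_def)
  have "V \<noteq> {1..n}"
  proof
    assume eq: "V = {1..n}"
    have "W = V" if "W \<in> \<pi>" for W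
    proof (rule ccontr)
      assume "W \<noteq> V"
      then have "W \<inter> V = {}" using p assms(3) that by (auto simp: partition_on_def disjoint_def)
      moreover have "W \<subseteq> {1..n}" "W \<noteq> {}" using p that by (auto simp: partition_on_def)
      ultimately show False using eq by auto
    qed
    then have "\<pi> = {V}" using assms(3) by blast
    then show False using assms(2) eq by simp
  qed
  then have "card V < card {1..n}" using sub by (intro psubset_card_mono) auto
  then show ?thesis by simp
qed

lemma length_entries: "length (entries as V) = card V"
  by (simp add: entries_def)

text \<open>Recursion obtained from the moment-cumulant formula \<open>\<tau>(a\<^sub>1\<cdots>a\<^sub>n) = \<Sum>\<^bsub>\<pi> \<in> NC(n)\<^esub> \<kappa>\<^sub>\<pi>[a\<^sub>1,\<dots>,a\<^sub>n]\<close>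
  by isolating the one-block partition, whose contribution is \<open>\<kappa>\<^sub>n(a\<^sub>1,\<dots>,a\<^sub>n)\<close>.\<close>

function free_cumulant :: "('a::unital_cstar_algebra \<Rightarrow> complex) \<Rightarrow> 'a list \<Rightarrow> complex" where
  "free_cumulant \<tau> as = \<tau> (prod_list as)
     - (\<Sum>\<pi> \<in> NC (length as) - {{{1..length as}}}. \<Prod>V\<in>\<pi>. free_cumulant \<tau> (entries as V))"
  by auto
termination
proof (relation "Wellfounded.measure (\<lambda>(\<tau>, as). length as)")
  fix as :: "'a list" and \<pi> V and \<tau> :: "'a \<Rightarrow> complex"
  assume "\<pi> \<in> NC (length as) - {{{1..length as}}}" "V \<in> \<pi>"
  then have "card V < length as" by (auto intro: NC_block_proper)
  then show "((\<tau>, entries as V), (\<tau>, as)) \<in> Wellfounded.measure (\<lambda>(\<tau>, as). length as)"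
    by (simp add: length_entries)
qed auto

declare free_cumulant.simps [simp del]

definition kappa :: "('a::unital_cstar_algebra \<Rightarrow> complex) \<Rightarrow> nat \<Rightarrow> 'a \<Rightarrow> complex" where
  "kappa \<tau> n a = free_cumulant \<tau> (replicate n a)"

definition kappa_part :: "('a::unital_cstar_algebra \<Rightarrow> complex) \<Rightarrow> nat set set \<Rightarrow> 'a \<Rightarrow> complex" where
  "kappa_part \<tau> \<rho> a = (\<Prod>Z\<in>\<rho>. kappa \<tau> (card Z) a)"

lemma moment_cumulant:
  assumes "as \<noteq> []"
  shows "\<tau> (prod_list as) = (\<Sum>\<pi>\<in>NC (length as). \<Prod>V\<in>\<pi>. free_cumulant \<tau> (entries as V))"
proof -
  let ?n = "length as"
  let ?f = "\<lambda>\<pi>. \<Prod>V\<in>\<pi>. free_cumulant \<tau> (entries as V)"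
  have fin: "finite (NC ?n)"
    by (rule finite_subset[of _ "Pow (Pow {1..?n})"]) (auto simp: NC_def partition_on_def)
  have one: "{{1..?n}} \<in> NC ?n"
    using assms by (simp add: NC_def partition_on_def noncrossing_def Suc_le_eq)
  have "entries as {1..?n} = as"
    by (rule nth_equalityI)
      (auto simp: entries_def simp del: upt_Suc simp flip: atLeastLessThanSuc_atLeastAtMost)
  then have top: "?f {{1..?n}} = free_cumulant \<tau> as" by simp
  have "sum ?f (NC ?n) = free_cumulant \<tau> as + sum ?f (NC ?n - {{{1..?n}}})"
    using sum.remove[OF fin one, of ?f] unfolding top .
  then show ?thesis
    using free_cumulant.simps[of \<tau> as] by (metis add.commute diff_add_cancel)
qed

definition semicircular :: "('a::unital_cstar_algebra \<Rightarrow> complex) \<Rightarrow> 'a \<Rightarrow> bool" where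
  "semicircular \<tau> s \<longleftrightarrow> self_adjoint s \<and> (\<forall>n\<ge>1. n \<noteq> 2 \<longrightarrow> kappa \<tau> n s = 0) \<and>
     kappa \<tau> 2 s \<in> \<real> \<and> 0 < Re (kappa \<tau> 2 s)"

end

theory Submission
  imports Defs "HOL-Computational_Algebra.Formal_Power_Series"
begin

text \<open>
  Freeness yields Schwinger-Dyson equations for words in \<open>x\<close> and \<open>s\<close>: a moment \<open>\<tau>(x w)\<close> is obtained by
  letting \<open>x\<close> choose the other members of its block in \<open>w\<close>, and \<open>\<tau>(s w)\<close> is the free difference
  quotient of \<open>w\<close>. Both sides being linear in \<open>w\<close>, they need only be compared on alternating products of
  centred powers, where all but trivial terms vanish.

  Apply this to words expanding \<open>z\<^sup>n\<close> for \<open>z = x + \<i>[x,s]\<close>, and write \<open>a\<close> and \<open>d\<close> for the generating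
  series of \<open>\<tau>(z\<^sup>n)\<close> and \<open>\<tau>(s z\<^sup>n s)\<close> in a variable \<open>t\<close>. As \<open>\<tau>(s z\<^sup>n) = 0\<close>, the equations reduce to a
  \<open>2 \<times> 2\<close> transfer system which with \<open>u = t a\<close> and \<open>N = d / a\<close> reads
  \<open>q\<^sub>k = \<kappa>\<^sub>k + u q\<^bsub>k+1\<^esub> + u\<^sup>2 N q\<^bsub>k+2\<^esub>\<close>, \<open>N = 1 + u\<^sup>2 N q\<^sub>2\<close>, \<open>a = 1 + u q\<^sub>1 + 2 u\<^sup>2 N q\<^sub>2\<close>.
  The block recursion for non-crossing partitions shows that the right-hand side of the theorem,
  as a series in \<open>u\<close>, solves the same system, so it is the cumulant series of \<open>z\<close>, which is
  characterised by \<open>a = 1 + C(t a)\<close>.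
\<close>

section \<open>Block recursion for non-crossing partitions\<close>

definition NC_on :: "nat set \<Rightarrow> nat set set set" where
  "NC_on A = {\<pi>. partition_on A \<pi> \<and> noncrossing \<pi>}"

definition NC_sum :: "(nat set \<Rightarrow> complex) \<Rightarrow> nat set \<Rightarrow> complex" where
  "NC_sum w A = (\<Sum>\<pi>\<in>NC_on A. \<Prod>V\<in>\<pi>. w V)"

lemma finite_NC_on: "finite A \<Longrightarrow> finite (NC_on A)"
  by (rule finite_subset[of _ "Pow (Pow A)"]) (auto simp: NC_on_def partition_on_def)

lemma NC_on_finite_blocks: "finite A \<Longrightarrow> \<pi> \<in> NC_on A \<Longrightarrow> finite \<pi>"
  by (auto simp: NC_on_def intro: finite_elements)

lemma NC_onD:
  assumes "\<pi> \<in> NC_on A"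
  shows "\<Union>\<pi> = A" and "{} \<notin> \<pi>"
    and "V \<in> \<pi> \<Longrightarrow> W \<in> \<pi> \<Longrightarrow> c \<in> V \<Longrightarrow> c \<in> W \<Longrightarrow> V = W"
    and "V \<in> \<pi> \<Longrightarrow> W \<in> \<pi> \<Longrightarrow> a < b \<Longrightarrow> b < c \<Longrightarrow> c < d \<Longrightarrow> a \<in> V \<Longrightarrow> c \<in> V \<Longrightarrow> b \<in> W \<Longrightarrow> d \<in> W
      \<Longrightarrow> V = W"
proof -
  have p: "\<Union>\<pi> = A" "disjoint \<pi>" "{} \<notin> \<pi>" and nc: "noncrossing \<pi>"
    using assms by (auto simp: NC_on_def partition_on_def)
  show "\<Union>\<pi> = A" "{} \<notin> \<pi>" by fact+
  show "V = W" if "V \<in> \<pi>" "W \<in> \<pi>" "c \<in> V" "c \<in> W"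
    using disjointD[OF p(2) that(1,2)] that by blast
  show "V = W" if "V \<in> \<pi>" "W \<in> \<pi>" "a < b" "b < c" "c < d" "a \<in> V" "c \<in> V" "b \<in> W" "d \<in> W"
  proof (rule ccontr)
    assume "V \<noteq> W"
    with bspec[OF bspec[OF nc[unfolded noncrossing_def] that(1)] that(2)]
    have "\<not> (\<exists>a b c d. a < b \<and> b < c \<and> c < d \<and> a \<in> V \<and> b \<in> W \<and> c \<in> V \<and> d \<in> W)"
      by (rule mp)
    then show False using that by blast
  qed
qed

lemma NC_onI:
  assumes "\<Union>\<pi> = A" and "{} \<notin> \<pi>"
    and "\<And>V W c. V \<in> \<pi> \<Longrightarrow> W \<in> \<pi> \<Longrightarrow> c \<in> V \<Longrightarrow> c \<in> W \<Longrightarrow> V = W"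
    and "\<And>V W a b c d. V \<in> \<pi> \<Longrightarrow> W \<in> \<pi> \<Longrightarrow> a < b \<Longrightarrow> b < c \<Longrightarrow> c < d \<Longrightarrow> a \<in> V \<Longrightarrow> c \<in> V
      \<Longrightarrow> b \<in> W \<Longrightarrow> d \<in> W \<Longrightarrow> V = W"
  shows "\<pi> \<in> NC_on A"
proof -
  have "disjoint \<pi>" unfolding disjoint_def using assms(3) by blast
  moreover have "noncrossing \<pi>" unfolding noncrossing_def
    by (intro ballI impI notI, elim exE conjE) (use assms(4) in simp)
  ultimately show ?thesis using assms(1,2) by (simp add: NC_on_def partition_on_def)
qed

lemma NC_on_empty: "NC_on {} = {{}}"
  unfolding NC_on_def partition_on_empty noncrossing_def by blast

lemma NC_sum_empty [simp]: "NC_sum w {} = 1"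
  by (simp add: NC_sum_def NC_on_empty)

lemma NC_sum_cong:
  assumes "\<And>V. V \<subseteq> A \<Longrightarrow> w V = w' V"
  shows "NC_sum w A = NC_sum w' A"
  unfolding NC_sum_def
  by (intro sum.cong prod.cong refl assms) (auto simp: NC_on_def partition_on_def)

text \<open>In a partition of \<open>{m..<n}\<close> this says that \<open>b\<close> is the successor of \<open>m\<close> in its block.\<close>

definition linked :: "nat set set \<Rightarrow> nat \<Rightarrow> nat \<Rightarrow> bool" where
  "linked \<pi> m b \<longleftrightarrow> (\<exists>V\<in>\<pi>. m \<in> V \<and> b \<in> V \<and> V \<inter> {m<..<b} = {})"

text \<open>A singleton takes part in no crossing, so deleting the block \<open>{m}\<close> is a
  bijection onto the non-crossing partitions of the remaining positions.\<close>

lemma NC_sum_singleton_part: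
  "(\<Sum>\<pi> | \<pi> \<in> NC_on {m..<n} \<and> {m} \<in> \<pi>. \<Prod>V\<in>\<pi>. w V) = w {m} * NC_sum w {Suc m..<n}"
  if "m < n"
proof -
  have notin: "{m} \<notin> \<pi>" if "\<pi> \<in> NC_on {Suc m..<n}" for \<pi>
  proof
    assume "{m} \<in> \<pi>"
    then have "m \<in> \<Union>\<pi>" by blast
    then show False unfolding NC_onD(1)[OF that] by simp
  qed
  have "(\<Sum>\<pi> | \<pi> \<in> NC_on {m..<n} \<and> {m} \<in> \<pi>. \<Prod>V\<in>\<pi>. w V)
      = (\<Sum>\<pi>\<in>NC_on {Suc m..<n}. w {m} * (\<Prod>V\<in>\<pi>. w V))"
  proof (rule sum.reindex_bij_witness[where i = "insert {m}" and j = "\<lambda>\<pi>. \<pi> - {{m}}"])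
    fix \<pi> assume a: "\<pi> \<in> {\<pi>. \<pi> \<in> NC_on {m..<n} \<and> {m} \<in> \<pi>}"
    then have p: "\<pi> \<in> NC_on {m..<n}" and s: "{m} \<in> \<pi>" by auto
    show "insert {m} (\<pi> - {{m}}) = \<pi>" using s by auto
    have m: "m \<notin> V" if "V \<in> \<pi> - {{m}}" for V
      using NC_onD(3)[OF p, of V "{m}" m] s that by auto
    have "\<Union>(\<pi> - {{m}}) = \<Union>\<pi> - {m}" using m by blast
    also have "\<dots> = {Suc m..<n}" unfolding NC_onD(1)[OF p] by auto
    finally show "\<pi> - {{m}} \<in> NC_on {Suc m..<n}"
      by (rule NC_onI) (use NC_onD(2-4)[OF p] in simp_all)
    show "w {m} * prod w (\<pi> - {{m}}) = prod w \<pi>"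
      using prod.remove[OF NC_on_finite_blocks[OF _ p] s, of w] by simp
  next
    fix \<pi> assume p: "\<pi> \<in> NC_on {Suc m..<n}"
    show "insert {m} \<pi> - {{m}} = \<pi>" using notin[OF p] by auto
    have U: "\<Union>\<pi> = {Suc m..<n}" by (rule NC_onD(1)[OF p])
    have gt: "m < c" if "V \<in> \<pi>" "c \<in> V" for V c
    proof -
      have "c \<in> \<Union>\<pi>" using that by blast
      then show ?thesis unfolding U by simp
    qed
    have "insert {m} \<pi> \<in> NC_on {m..<n}"
    proof (rule NC_onI)
      show "\<Union>(insert {m} \<pi>) = {m..<n}" using U \<open>m < n\<close> by auto
      show "{} \<notin> insert {m} \<pi>" using NC_onD(2)[OF p] by auto
    next
      fix V W c assume "V \<in> insert {m} \<pi>" "W \<in> insert {m} \<pi>" "c \<in> V" "c \<in> W"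
      then show "V = W" using NC_onD(3)[OF p, of V W c] gt[of V c] gt[of W c] by auto
    next
      fix V W a b c d assume a: "V \<in> insert {m} \<pi>" "W \<in> insert {m} \<pi>" "a < b" "b < c" "c < d"
        "a \<in> V" "c \<in> V" "b \<in> W" "d \<in> W"
      then have "V \<noteq> {m}" "W \<noteq> {m}" by auto
      then show "V = W" using NC_onD(4)[OF p, of V W a b c d] a by simp
    qed
    then show "insert {m} \<pi> \<in> {\<pi>. \<pi> \<in> NC_on {m..<n} \<and> {m} \<in> \<pi>}" by simp
  qed
  then show ?thesis by (simp add: NC_sum_def sum_distrib_left)
qed

text \<open>The arc from \<open>m\<close> to its successor \<open>b\<close> separates the rest:
  blocks meeting the gap stay inside it, and all others live on \<open>{b..<n}\<close> once
  \<open>m\<close> is removed. Conversely \<open>m\<close> can be glued back to the block of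
  \<open>b\<close>, hence the modified weight in the second factor.\<close>

lemma NC_sum_linked_part:
  fixes m b n :: nat
  assumes mb: "m < b" "b < n"
  shows "(\<Sum>\<pi> | \<pi> \<in> NC_on {m..<n} \<and> linked \<pi> m b. \<Prod>V\<in>\<pi>. w V)
    = NC_sum w {Suc m..<b} * NC_sum (\<lambda>V. if b \<in> V then w (insert m V) else w V) {b..<n}"
proof -
  \<comment> \<open>\<open>g\<close> glues \<open>m\<close> back to the block of \<open>b\<close>;
    \<open>lo\<close> collects the blocks inside the gap between \<open>m\<close> and
    \<open>b\<close>.\<close>
  define g where "g V = (if b \<in> V then insert m V else V)" for V :: "nat set"
  let ?w = "\<lambda>V. if b \<in> V then w (insert m V) else w V"
  define lo where "lo \<pi> = {V \<in> \<pi>. V \<subseteq> {Suc m..<b}}" for \<pi> :: "nat set set"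
  have "(\<Sum>\<pi> | \<pi> \<in> NC_on {m..<n} \<and> linked \<pi> m b. \<Prod>V\<in>\<pi>. w V)
    = (\<Sum>(\<rho>, \<theta>)\<in>NC_on {Suc m..<b} \<times> NC_on {b..<n}. (\<Prod>V\<in>\<rho>. w V) * (\<Prod>V\<in>\<theta>. ?w V))"
  proof (rule sum.reindex_bij_witness[where i = "\<lambda>(\<rho>, \<theta>). \<rho> \<union> g ` \<theta>"
        and j = "\<lambda>\<pi>. (lo \<pi>, (\<lambda>V. V - {m}) ` (\<pi> - lo \<pi>))"])
    fix \<pi> assume "\<pi> \<in> {\<pi>. \<pi> \<in> NC_on {m..<n} \<and> linked \<pi> m b}"
    then obtain V0 where p: "\<pi> \<in> NC_on {m..<n}"
      and V0: "V0 \<in> \<pi>" "m \<in> V0" "b \<in> V0" "V0 \<inter> {m<..<b} = {}"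
      by (auto simp: linked_def)
    have U: "\<Union>\<pi> = {m..<n}" by (rule NC_onD(1)[OF p])
    have rng: "m \<le> c \<and> c < n" if "V \<in> \<pi>" "c \<in> V" for V c
    proof -
      have "c \<in> \<Union>\<pi>" using that by blast
      then show ?thesis unfolding U by simp
    qed
    have ex: "\<exists>V\<in>\<pi>. c \<in> V" if "m \<le> c" "c < n" for c
    proof -
      have "c \<in> \<Union>\<pi>" unfolding U using that by simp
      then show ?thesis by blast
    qed
    have ne: "{} \<notin> \<pi>" by (rule NC_onD(2)[OF p])
    have V0lo: "V0 \<notin> lo \<pi>" using V0 by (auto simp: lo_def)
    \<comment> \<open>A block other than \<open>V0\<close> with a point \<open>e\<close> outside the
      gap lies right of \<open>b\<close>: a point \<open>d\<close> of it in the gap would cross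
      \<open>V0\<close>, as \<open>m < d < b < e\<close>.\<close>
    have hi: "V \<subseteq> {Suc b..<n}" if V: "V \<in> \<pi> - lo \<pi>" "V \<noteq> V0" for V
    proof
      fix d assume d: "d \<in> V"
      have nm: "c \<noteq> m \<and> c \<noteq> b \<and> m \<le> c \<and> c < n" if "c \<in> V" for c
        using that V NC_onD(3)[OF p, of V V0 c] V0 rng[of V c] by auto
      obtain e where e: "e \<in> V" "e \<notin> {Suc m..<b}" using V(1) unfolding lo_def by blast
      have e': "b < e" using e nm[OF e(1)] by auto
      have "\<not> d < b"
      proof
        assume "d < b"
        moreover have "m < d" using nm[OF d] by auto
        ultimately show False
          using NC_onD(4)[OF p V0(1), of V m d b e] V V0 e' e(1) d by blast
      qed
      then show "d \<in> {Suc b..<n}" using nm[OF d] by auto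
    qed
    have gm: "g (V - {m}) = V" if "V \<in> \<pi> - lo \<pi>" for V
    proof (cases "V = V0")
      case True then show ?thesis using V0 mb by (auto simp: g_def)
    next
      case False
      then have "m \<notin> V" "b \<notin> V" using hi[OF that] mb by auto
      then show ?thesis by (auto simp: g_def)
    qed
    have gim: "g ` ((\<lambda>V. V - {m}) ` (\<pi> - lo \<pi>)) = \<pi> - lo \<pi>"
      using gm by (force simp: image_image)
    show "(case (lo \<pi>, (\<lambda>V. V - {m}) ` (\<pi> - lo \<pi>)) of (\<rho>, \<theta>) \<Rightarrow> \<rho> \<union> g ` \<theta>) = \<pi>"
      using gim by (auto simp: lo_def)
    have lo: "lo \<pi> \<in> NC_on {Suc m..<b}"
    proof (rule NC_onI)
      show "\<Union>(lo \<pi>) = {Suc m..<b}"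
      proof
        show "{Suc m..<b} \<subseteq> \<Union>(lo \<pi>)"
        proof
          fix c assume c: "c \<in> {Suc m..<b}"
          then obtain V where V: "V \<in> \<pi>" "c \<in> V" using ex[of c] mb by auto
          have "V \<noteq> V0" using V V0 c by auto
          moreover have "\<not> V \<subseteq> {Suc b..<n}" using V c by auto
          ultimately have "V \<in> lo \<pi>" using hi[of V] V by blast
          then show "c \<in> \<Union>(lo \<pi>)" using V by auto
        qed
      qed (auto simp: lo_def)
    qed (use NC_onD(2-4)[OF p] in \<open>auto simp: lo_def\<close>)
    have th: "(\<lambda>V. V - {m}) ` (\<pi> - lo \<pi>) \<in> NC_on {b..<n}"
    proof (rule NC_onI)
      show "\<Union>((\<lambda>V. V - {m}) ` (\<pi> - lo \<pi>)) = {b..<n}"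
      proof
        show "\<Union>((\<lambda>V. V - {m}) ` (\<pi> - lo \<pi>)) \<subseteq> {b..<n}"
        proof
          fix c assume "c \<in> \<Union>((\<lambda>V. V - {m}) ` (\<pi> - lo \<pi>))"
          then obtain V where V: "V \<in> \<pi> - lo \<pi>" "c \<in> V" "c \<noteq> m" by auto
          show "c \<in> {b..<n}"
          proof (cases "V = V0")
            case True
            have "c \<notin> {m<..<b}" using V True V0 by blast
            then show ?thesis using rng[of V c] V by auto
          next
            case False then show ?thesis using hi[OF V(1)] V(2) by auto
          qed
        qed
        show "{b..<n} \<subseteq> \<Union>((\<lambda>V. V - {m}) ` (\<pi> - lo \<pi>))"
        proof
          fix c assume c: "c \<in> {b..<n}"
          then obtain V where V: "V \<in> \<pi>" "c \<in> V" using ex[of c] mb by auto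
          have "V \<notin> lo \<pi>" "c \<noteq> m" using V c mb by (auto simp: lo_def)
          then show "c \<in> \<Union>((\<lambda>V. V - {m}) ` (\<pi> - lo \<pi>))" using V by auto
        qed
      qed
      show "{} \<notin> (\<lambda>V. V - {m}) ` (\<pi> - lo \<pi>)"
      proof
        assume "{} \<in> (\<lambda>V. V - {m}) ` (\<pi> - lo \<pi>)"
        then obtain V where V: "V \<in> \<pi> - lo \<pi>" "V - {m} = {}" by auto
        show False
        proof (cases "V = V0")
          case True then show ?thesis using V V0 mb by auto
        next
          case False
          then have "m \<notin> V" using hi[OF V(1)] mb by auto
          then show ?thesis using V ne by auto
        qed
      qed
    next
      fix V W c assume "V \<in> (\<lambda>V. V - {m}) ` (\<pi> - lo \<pi>)" "W \<in> (\<lambda>V. V - {m}) ` (\<pi> - lo \<pi>)" "c \<in> V" "c \<in> W"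
      then show "V = W" by (elim imageE) (use NC_onD(3)[OF p, of _ _ c] in auto)
    next
      fix V W a b' c d assume "V \<in> (\<lambda>V. V - {m}) ` (\<pi> - lo \<pi>)" "W \<in> (\<lambda>V. V - {m}) ` (\<pi> - lo \<pi>)"
        "a < b'" "b' < c" "c < d" "a \<in> V" "c \<in> V" "b' \<in> W" "d \<in> W"
      then obtain V' W' where "V = V' - {m}" "W = W' - {m}" "V' \<in> \<pi>" "W' \<in> \<pi>"
        "a \<in> V'" "c \<in> V'" "b' \<in> W'" "d \<in> W'" by auto
      then show "V = W" using NC_onD(4)[OF p, of V' W' a b' c d] \<open>a < b'\<close> \<open>b' < c\<close> \<open>c < d\<close> by simp
    qed
    show "(lo \<pi>, (\<lambda>V. V - {m}) ` (\<pi> - lo \<pi>)) \<in> NC_on {Suc m..<b} \<times> NC_on {b..<n}"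
      using lo th by simp
    have inj: "inj_on (\<lambda>V. V - {m}) (\<pi> - lo \<pi>)"
      by (rule inj_on_inverseI[of _ g]) (rule gm)
    have "(\<Prod>V\<in>(\<lambda>V. V - {m}) ` (\<pi> - lo \<pi>). ?w V) = (\<Prod>V\<in>\<pi> - lo \<pi>. ?w (V - {m}))"
      using prod.reindex[OF inj, of ?w] by (simp only: o_def)
    also have "\<dots> = (\<Prod>V\<in>\<pi> - lo \<pi>. w (g (V - {m})))"
      by (rule prod.cong) (auto simp: g_def)
    also have "\<dots> = (\<Prod>V\<in>\<pi> - lo \<pi>. w V)"
      by (rule prod.cong) (simp_all only: gm)
    finally have "(\<Prod>V\<in>lo \<pi>. w V) * (\<Prod>V\<in>(\<lambda>V. V - {m}) ` (\<pi> - lo \<pi>). ?w V)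
        = (\<Prod>V\<in>lo \<pi>. w V) * (\<Prod>V\<in>\<pi> - lo \<pi>. w V)" by simp
    also have "\<dots> = (\<Prod>V\<in>\<pi>. w V)"
      using NC_on_finite_blocks[OF _ p]
      by (subst mult.commute, intro prod.subset_diff[symmetric]) (auto simp: lo_def)
    finally show "(case (lo \<pi>, (\<lambda>V. V - {m}) ` (\<pi> - lo \<pi>)) of
        (\<rho>, \<theta>) \<Rightarrow> (\<Prod>V\<in>\<rho>. w V) * (\<Prod>V\<in>\<theta>. ?w V)) = (\<Prod>V\<in>\<pi>. w V)" by simp
  next
    fix q assume "q \<in> NC_on {Suc m..<b} \<times> NC_on {b..<n}"
    then obtain \<rho> \<theta> where q: "q = (\<rho>, \<theta>)" and r: "\<rho> \<in> NC_on {Suc m..<b}" and t: "\<theta> \<in> NC_on {b..<n}"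
      by (cases q) auto
    note U = NC_onD(1)[OF r] NC_onD(1)[OF t]
    have rho: "m < c \<and> c < b" if "V \<in> \<rho>" "c \<in> V" for V c
    proof -
      have "c \<in> {Suc m..<b}" using that U by blast
      then show ?thesis by auto
    qed
    have th: "b \<le> c \<and> c < n" if "V \<in> \<theta>" "c \<in> V" for V c
    proof -
      have "c \<in> {b..<n}" using that U by blast
      then show ?thesis by auto
    qed
    have gth: "c = m \<and> b \<in> V \<or> c \<in> V" if "c \<in> g V" for V c
      using that by (auto simp: g_def split: if_splits)
    have gge: "c = m \<or> b \<le> c" if "V \<in> g ` \<theta>" "c \<in> V" for V c
      using that gth th by blast
    have glo: "lo (\<rho> \<union> g ` \<theta>) = \<rho>"
    proof -
      have "V \<subseteq> {Suc m..<b}" if "V \<in> \<rho>" for V using U that by blast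
      moreover have "\<not> g V \<subseteq> {Suc m..<b}" if "V \<in> \<theta>" for V
      proof
        assume a: "g V \<subseteq> {Suc m..<b}"
        have "V \<noteq> {}" using NC_onD(2)[OF t] that by auto
        then obtain c where c: "c \<in> V" by blast
        then have "c \<in> g V" by (auto simp: g_def)
        then show False using a th[OF that c] by auto
      qed
      ultimately show ?thesis by (auto simp: lo_def)
    qed
    have disj: "\<rho> \<inter> g ` \<theta> = {}"
    proof -
      have "V \<noteq> g W" if "V \<in> \<rho>" "W \<in> \<theta>" for V W
      proof
        assume e: "V = g W"
        have "V \<noteq> {}" using NC_onD(2)[OF r] that by auto
        then obtain c where c: "c \<in> V" by blast
        show False using rho[OF that(1) c] gge[of V c] c e that by auto
      qed
      then show ?thesis by auto
    qed
    have gm: "g V - {m} = V" if "V \<in> \<theta>" for V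
    proof -
      have "m \<notin> V" using th[OF that, of m] mb by auto
      then show ?thesis by (auto simp: g_def)
    qed
    have ginj: "inj_on g \<theta>" by (rule inj_on_inverseI[of _ "\<lambda>V. V - {m}"]) (rule gm)
    have "(\<lambda>V. V - {m}) ` (\<rho> \<union> g ` \<theta> - \<rho>) = (\<lambda>V. V - {m}) ` (g ` \<theta>)"
      using disj by (intro arg_cong2[of _ _ _ _ image]) auto
    also have "\<dots> = \<theta>" using gm by (force simp: image_image)
    finally show "(\<lambda>\<pi>. (lo \<pi>, (\<lambda>V. V - {m}) ` (\<pi> - lo \<pi>))) (case q of (\<rho>, \<theta>) \<Rightarrow> \<rho> \<union> g ` \<theta>) = q"
      using glo by (simp add: q)
    obtain B where B: "B \<in> \<theta>" "b \<in> B"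
    proof -
      have "b \<in> \<Union>\<theta>" unfolding U(2) using mb by auto
      then show thesis using that by blast
    qed
    have same: "V = W" if "V \<in> \<theta>" "W \<in> \<theta>" "b \<in> V" "b \<in> W" for V W
      using NC_onD(3)[OF t] that by blast
    have "\<rho> \<union> g ` \<theta> \<in> NC_on {m..<n}"
    proof (rule NC_onI)
      have "\<Union>(g ` \<theta>) = insert m {b..<n}"
      proof -
        have "\<Union>(g ` \<theta>) = insert m (\<Union>\<theta>)" using B by (auto simp: g_def split: if_splits)
        then show ?thesis using U by simp
      qed
      then show "\<Union>(\<rho> \<union> g ` \<theta>) = {m..<n}" using U(1) mb by auto
      show "{} \<notin> \<rho> \<union> g ` \<theta>" using NC_onD(2)[OF r] NC_onD(2)[OF t] by (auto simp: g_def split: if_splits)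
    next
      fix V W c assume a: "V \<in> \<rho> \<union> g ` \<theta>" "W \<in> \<rho> \<union> g ` \<theta>" "c \<in> V" "c \<in> W"
      consider "V \<in> \<rho>" "W \<in> \<rho>" | "V \<in> g ` \<theta>" "W \<in> g ` \<theta>" | "V \<in> \<rho>" "W \<in> g ` \<theta>" | "V \<in> g ` \<theta>" "W \<in> \<rho>"
        using a by blast
      then show "V = W"
      proof cases
        case 1 then show ?thesis using NC_onD(3)[OF r] a by blast
      next
        case 2
        then obtain V' W' where V': "V = g V'" "V' \<in> \<theta>" "W = g W'" "W' \<in> \<theta>" by auto
        show ?thesis
        proof (cases "c = m")
          case True
          then have "b \<in> V'" "b \<in> W'" using a V' gth th[of V' m] th[of W' m] mb by force+
          then show ?thesis using same V' by blast
        next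
          case False
          then have "c \<in> V'" "c \<in> W'" using gth a V' by blast+
          then show ?thesis using NC_onD(3)[OF t] V' by blast
        qed
      next
        case 3 then show ?thesis using rho[of V c] gge[of W c] a by auto
      next
        case 4 then show ?thesis using rho[of W c] gge[of V c] a by auto
      qed
    next
      fix V W a b' c d assume a: "V \<in> \<rho> \<union> g ` \<theta>" "W \<in> \<rho> \<union> g ` \<theta>"
        and o: "a < b'" "b' < c" "c < d" and i: "a \<in> V" "c \<in> V" "b' \<in> W" "d \<in> W"
      consider "V \<in> \<rho>" "W \<in> \<rho>" | "V \<in> g ` \<theta>" "W \<in> g ` \<theta>" | "V \<in> \<rho>" "W \<in> g ` \<theta>" | "V \<in> g ` \<theta>" "W \<in> \<rho>"
        using a by blast
      then show "V = W"
      proof cases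
        case 1 then show ?thesis using NC_onD(4)[OF r] o i by blast
      next
        case 2
        then obtain V' W' where V': "V = g V'" "V' \<in> \<theta>" "W = g W'" "W' \<in> \<theta>" by auto
        have am: "m \<le> a" using gge[OF 2(1) i(1)] mb by auto
        then have c: "c \<in> V'" and b': "b' \<in> W'" and d: "d \<in> W'"
          using gth i V' o by (metis leD less_trans)+
        \<comment> \<open>If \<open>a = m\<close>, then \<open>a\<close> was glued on and
          \<open>b\<close> takes its place: either \<open>b' = b\<close> and the blocks meet, or
          \<open>b < b' < c < d\<close> is a crossing inside \<open>\<theta>\<close>.\<close>
        show ?thesis
        proof (cases "a = m")
          case True
          then have bV: "b \<in> V'" using i V' gth th[of V' m] mb by force
          show ?thesis
          proof (cases "b' = b")
            case True then show ?thesis using same V' bV b' by blast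
          next
            case False
            then have "b < b'" using th[OF V'(4) b'] by auto
            then show ?thesis using NC_onD(4)[OF t V'(2,4), of b b' c d] bV b' c d o V' by blast
          qed
        next
          case False
          then have "a \<in> V'" using gth i V' by blast
          then show ?thesis using NC_onD(4)[OF t V'(2,4), of a b' c d] b' c d o V' by blast
        qed
      next
        case 3 then show ?thesis using rho[OF 3(1) i(1)] rho[OF 3(1) i(2)] gge[OF 3(2) i(3)] o by auto
      next
        case 4 then show ?thesis using rho[OF 4(2) i(3)] rho[OF 4(2) i(4)] gge[OF 4(1) i(2)] o by auto
      qed
    qed
    moreover have "linked (\<rho> \<union> g ` \<theta>) m b"
      unfolding linked_def
    proof (intro bexI conjI)
      show "g B \<in> \<rho> \<union> g ` \<theta>" using B by simp
      show "m \<in> g B" "b \<in> g B" using B by (auto simp: g_def)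
      show "g B \<inter> {m<..<b} = {}" using B th[OF B(1)] by (force simp: g_def)
    qed
    ultimately show "(case q of (\<rho>, \<theta>) \<Rightarrow> \<rho> \<union> g ` \<theta>) \<in> {\<pi>. \<pi> \<in> NC_on {m..<n} \<and> linked \<pi> m b}"
      by (simp add: q)
  qed
  also have "\<dots> = NC_sum w {Suc m..<b} * NC_sum ?w {b..<n}"
    by (simp add: NC_sum_def sum_product sum.cartesian_product)
  finally show ?thesis .
qed

text \<open>Sorts the partitions by the successor of \<open>m\<close> in its block; as
  \<open>m\<close> is the least position, having no successor means being a singleton.\<close>

lemma NC_sum_rec:
  assumes "m < n"
  shows "NC_sum w {m..<n} = w {m} * NC_sum w {Suc m..<n} +
    (\<Sum>b\<in>{Suc m..<n}. NC_sum w {Suc m..<b} *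
       NC_sum (\<lambda>V. if b \<in> V then w (insert m V) else w V) {b..<n})"
proof -
  let ?A = "{\<pi>. \<pi> \<in> NC_on {m..<n} \<and> {m} \<in> \<pi>}"
  let ?L = "\<lambda>b. {\<pi>. \<pi> \<in> NC_on {m..<n} \<and> linked \<pi> m b}"
  let ?w = "\<lambda>\<pi>. \<Prod>V\<in>\<pi>. w V"
  have fin: "finite (NC_on {m..<n})" by (simp add: finite_NC_on)
  have split: "NC_on {m..<n} = ?A \<union> (\<Union>b\<in>{Suc m..<n}. ?L b)"
  proof -
    have "\<exists>b\<in>{Suc m..<n}. linked \<pi> m b" if p: "\<pi> \<in> NC_on {m..<n}" and nm: "{m} \<notin> \<pi>" for \<pi>
    proof -
      have U: "\<Union>\<pi> = {m..<n}" by (rule NC_onD(1)[OF p])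
      have "m \<in> \<Union>\<pi>" using U assms by simp
      then obtain V where V: "V \<in> \<pi>" "m \<in> V" by blast
      have sub: "V \<subseteq> {m..<n}" using U V by blast
      then have f: "finite (V - {m})" by (simp add: finite_subset)
      have "V \<noteq> {m}" using V nm by auto
      then have ne: "V - {m} \<noteq> {}" using V by blast
      define b where "b = Min (V - {m})"
      have b: "b \<in> V - {m}" unfolding b_def by (rule Min_in[OF f ne])
      have "V \<inter> {m<..<b} = {}"
        using Min_le[OF f] by (fastforce simp: b_def)
      then show ?thesis using b V sub by (intro bexI[of _ b]) (auto simp: linked_def)
    qed
    then show ?thesis by auto
  qed
  have disj1: "?A \<inter> (\<Union>b\<in>{Suc m..<n}. ?L b) = {}"
  proof -
    have "False" if "\<pi> \<in> NC_on {m..<n}" "{m} \<in> \<pi>" "b \<in> {Suc m..<n}" "V \<in> \<pi>" "m \<in> V" "b \<in> V" for \<pi> b V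
      using NC_onD(3)[OF that(1,2,4), of m] that by auto
    then show ?thesis unfolding linked_def by blast
  qed
  have disj2: "?L b \<inter> ?L b' = {}" if b: "b \<in> {Suc m..<n}" "b' \<in> {Suc m..<n}" "b \<noteq> b'" for b b'
  proof -
    have "False" if p: "\<pi> \<in> NC_on {m..<n}" and l: "linked \<pi> m b" "linked \<pi> m b'" for \<pi>
    proof -
      obtain V where V: "V \<in> \<pi>" "m \<in> V" "b \<in> V" "V \<inter> {m<..<b} = {}" using l by (auto simp: linked_def)
      obtain W where W: "W \<in> \<pi>" "m \<in> W" "b' \<in> W" "W \<inter> {m<..<b'} = {}" using l by (auto simp: linked_def)
      have "V = W" using NC_onD(3)[OF p] V W by blast
      then show False using V W b by (cases "b < b'") auto
    qed
    then show ?thesis by auto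
  qed
  have "NC_sum w {m..<n} = sum ?w ?A + sum ?w (\<Union>b\<in>{Suc m..<n}. ?L b)"
    unfolding NC_sum_def by (subst split, rule sum.union_disjoint) (use fin disj1 in auto)
  also have "sum ?w (\<Union>b\<in>{Suc m..<n}. ?L b) = (\<Sum>b\<in>{Suc m..<n}. sum ?w (?L b))"
    by (rule sum.UNION_disjoint) (use fin disj2 in auto)
  also have "\<dots> = (\<Sum>b\<in>{Suc m..<n}. NC_sum w {Suc m..<b} *
       NC_sum (\<lambda>V. if b \<in> V then w (insert m V) else w V) {b..<n})"
    by (rule sum.cong) (auto intro!: NC_sum_linked_part)
  finally show ?thesis using NC_sum_singleton_part[OF assms] by simp
qed

section \<open>Recursions over lists of weights\<close>

primrec split_sum :: "('b list \<Rightarrow> 'b \<Rightarrow> 'b list \<Rightarrow> complex) \<Rightarrow> 'b list \<Rightarrow> complex" where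
  "split_sum h [] = 0"
| "split_sum h (c # w) = h [] c w + split_sum (\<lambda>u. h (c # u)) w"

lemma split_sum_conv_nth:
  "split_sum h w = (\<Sum>j<length w. h (take j w) (w ! j) (drop (Suc j) w))"
  by (induction w arbitrary: h) (simp_all add: sum.lessThan_Suc_shift del: sum.lessThan_Suc)

text \<open>As a \<open>fundef_cong\<close> rule it shows the function package that calls below
  \<open>split_sum\<close> only reach proper sublists; the termination of \<open>nc_moment\<close>
  and \<open>nc_open\<close> rests on it.\<close>

lemma split_sum_cong [fundef_cong]:
  assumes "w = w'" and "\<And>u c v. w' = u @ c # v \<Longrightarrow> h u c v = h' u c v"
  shows "split_sum h w = split_sum h' w'"
  unfolding assms(1) split_sum_conv_nth
  by (intro sum.cong refl assms(2)) (simp add: id_take_nth_drop)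

lemma split_sum_replicate:
  "split_sum h (replicate n c) = (\<Sum>j<n. h (replicate j c) c (replicate (n - Suc j) c))"
  unfolding split_sum_conv_nth by (intro sum.cong) (simp_all add: min_def)

text \<open>\<open>nc_moment \<kappa> ns\<close> sums over the non-crossing partitions of the positions of \<open>ns\<close>, a block of total
  weight \<open>m\<close> contributing \<open>\<kappa> m\<close>; in \<open>nc_open \<kappa> m ns\<close> there is in addition a block of current
  weight \<open>m\<close> to the left of \<open>ns\<close> which may still absorb positions.\<close>

function nc_moment :: "(nat \<Rightarrow> complex) \<Rightarrow> nat list \<Rightarrow> complex"
  and nc_open :: "(nat \<Rightarrow> complex) \<Rightarrow> nat \<Rightarrow> nat list \<Rightarrow> complex" where
  "nc_moment \<kappa> [] = 1"
| "nc_moment \<kappa> (b # ns) = nc_open \<kappa> b ns"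
| "nc_open \<kappa> m ns = \<kappa> m * nc_moment \<kappa> ns
     + split_sum (\<lambda>u b v. nc_moment \<kappa> u * nc_open \<kappa> (m + b) v) ns"
  by pat_completeness auto
termination
  \<comment> \<open>The extra 1 lets \<open>nc_open\<close> call \<open>nc_moment\<close> on the
    same list, while \<open>nc_moment\<close> always sheds a letter first.\<close>
  by (relation "Wellfounded.measure (case_sum (\<lambda>(\<kappa>, ns). 2 * length ns) (\<lambda>(\<kappa>, m, ns). 2 * length ns + 1))")
    auto

declare nc_open.simps [simp del]

text \<open>\<open>c\<close> is the weight that the block of \<open>m\<close> has gathered before
  reaching \<open>m\<close>. With it, \<open>NC_sum_rec\<close> matches the recursion of
  \<open>nc_open\<close>: a singleton closes the block, and linking \<open>m\<close> to
  \<open>b\<close> passes on \<open>c + g m\<close>. Gaps need the closed half and continuations the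
  open one, hence the joint induction.\<close>

lemma NC_sum_nc_open:
  "(m < n \<longrightarrow> NC_sum (\<lambda>V. \<kappa> ((if m \<in> V then c else 0) + sum g V)) {m..<n} = nc_open \<kappa> (c + g m) (map g [Suc m..<n]))
   \<and> NC_sum (\<lambda>V. \<kappa> (sum g V)) {m..<n} = nc_moment \<kappa> (map g [m..<n])"
proof (induction "n - m" arbitrary: m n c rule: less_induct)
  case less
  have op: "NC_sum (\<lambda>V. \<kappa> ((if m \<in> V then c else 0) + sum g V)) {m..<n} = nc_open \<kappa> (c + g m) (map g [Suc m..<n])"
    if mn: "m < n" for c
  proof -
    let ?w = "\<lambda>V. \<kappa> ((if m \<in> V then c else 0) + sum g V)"
    have cl: "NC_sum ?w {Suc m..<b} = nc_moment \<kappa> (map g [Suc m..<b])" if "b \<le> n" for b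
    proof -
      have "NC_sum ?w {Suc m..<b} = NC_sum (\<lambda>V. \<kappa> (sum g V)) {Suc m..<b}"
        by (rule NC_sum_cong) (auto dest: subsetD)
      also have "\<dots> = nc_moment \<kappa> (map g [Suc m..<b])" using less[of b "Suc m"] that mn by simp
      finally show ?thesis .
    qed
    have nx: "NC_sum (\<lambda>V. if b \<in> V then ?w (insert m V) else ?w V) {b..<n} = nc_open \<kappa> (c + g m + g b) (map g [Suc b..<n])"
      if "b \<in> {Suc m..<n}" for b
    proof -
      have "NC_sum (\<lambda>V. if b \<in> V then ?w (insert m V) else ?w V) {b..<n}
          = NC_sum (\<lambda>V. \<kappa> ((if b \<in> V then c + g m else 0) + sum g V)) {b..<n}"
      proof (rule NC_sum_cong)
        fix V assume V: "V \<subseteq> {b..<n}"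
        then have "finite V" "m \<notin> V" using that by (auto intro: finite_subset dest: subsetD)
        then show "(if b \<in> V then ?w (insert m V) else ?w V) = \<kappa> ((if b \<in> V then c + g m else 0) + sum g V)"
          by (simp add: ac_simps)
      qed
      also have "\<dots> = nc_open \<kappa> (c + g m + g b) (map g [Suc b..<n])"
        using less[of n b] that mn by auto
      finally show ?thesis .
    qed
    have "NC_sum ?w {m..<n} = \<kappa> (c + g m) * nc_moment \<kappa> (map g [Suc m..<n])
       + (\<Sum>b\<in>{Suc m..<n}. nc_moment \<kappa> (map g [Suc m..<b]) * nc_open \<kappa> (c + g m + g b) (map g [Suc b..<n]))"
      unfolding NC_sum_rec[OF mn] by (intro arg_cong2[of _ _ _ _ "(+)"] arg_cong2[of _ _ _ _ "(*)"] sum.cong)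
        (simp_all add: cl nx)
    also have "(\<Sum>b\<in>{Suc m..<n}. nc_moment \<kappa> (map g [Suc m..<b]) * nc_open \<kappa> (c + g m + g b) (map g [Suc b..<n]))
       = split_sum (\<lambda>u b v. nc_moment \<kappa> u * nc_open \<kappa> (c + g m + b) v) (map g [Suc m..<n])"
      unfolding split_sum_conv_nth
      by (rule sum.reindex_bij_witness[of _ "\<lambda>j. Suc m + j" "\<lambda>b. b - Suc m"])
        (auto simp: take_map drop_map take_upt drop_upt simp del: upt_Suc)
    finally show ?thesis by (subst nc_open.simps)
  qed
  have "NC_sum (\<lambda>V. \<kappa> (sum g V)) {m..<n} = nc_moment \<kappa> (map g [m..<n])"
  proof (cases "m < n")
    case True
    then show ?thesis using op[OF True, of 0] by (simp add: upt_conv_Cons)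
  qed simp
  with op show ?case by blast
qed

text \<open>Serves two purposes: unit weights give the moments of a single element, and interval
  lengths as weights give the inner sum over \<open>\<pi>\<close> in the theorem.\<close>

lemma NC_sum_eq_nc_moment:
  "(\<Sum>\<pi>\<in>NC (length ns). \<Prod>U\<in>\<pi>. \<kappa> (\<Sum>l\<in>U. ns ! (l - 1))) = nc_moment \<kappa> ns"
proof -
  have "map (\<lambda>l. ns ! (l - 1)) [1..<Suc (length ns)] = ns"
    by (rule nth_equalityI) (simp_all del: upt_Suc)
  then show ?thesis
    using NC_sum_nc_open[of 1 "Suc (length ns)" \<kappa> 0 "\<lambda>l. ns ! (l - 1)"]
    by (simp add: NC_sum_def NC_on_def NC_def atLeastLessThanSuc_atLeastAtMost del: upt_Suc)
qed

context faithful_tracial_state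
begin

text \<open>With equal arguments the cumulant of a block depends only on its size, which is its
  total weight for unit weights.\<close>

lemma power_moment: "\<tau> (a ^ n) = nc_moment (\<lambda>k. kappa \<tau> k a) (replicate n 1)"
proof (cases "n = 0")
  case True
  then show ?thesis by (simp add: unital)
next
  case False
  have e: "entries (replicate n a) V = replicate (card V) a" if "V \<subseteq> {1..n}" for V
  proof (rule nth_equalityI)
    fix i assume i: "i < length (entries (replicate n a) V)"
    have "finite V" using that finite_subset by blast
    then have "sorted_list_of_set V ! i \<in> V"
      using i by (metis length_entries nth_mem set_sorted_list_of_set length_sorted_list_of_set)
    then have "sorted_list_of_set V ! i - 1 < n" using that by fastforce
    then show "entries (replicate n a) V ! i = replicate (card V) a ! i"
      using i by (simp add: entries_def)
  qed (simp add: length_entries)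
  have "\<tau> (a ^ n) = (\<Sum>\<pi>\<in>NC n. \<Prod>V\<in>\<pi>. free_cumulant \<tau> (entries (replicate n a) V))"
    using moment_cumulant[of "replicate n a" \<tau>] False by (simp add: prod_list_replicate)
  also have "\<dots> = (\<Sum>\<pi>\<in>NC n. \<Prod>V\<in>\<pi>. kappa \<tau> (\<Sum>l\<in>V. replicate n 1 ! (l - 1)) a)"
  proof (intro sum.cong prod.cong refl)
    fix \<pi> V assume "\<pi> \<in> NC n" "V \<in> \<pi>"
    then have V: "V \<subseteq> {1..n}" by (auto simp: NC_def partition_on_def)
    have "(\<Sum>l\<in>V. replicate n (1::nat) ! (l - 1)) = (\<Sum>l\<in>V. 1)"
    proof (rule sum.cong)
      fix l assume "l \<in> V"
      then have "l - 1 < n" using V by fastforce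
      then show "replicate n (1::nat) ! (l - 1) = 1" by simp
    qed simp
    then show "free_cumulant \<tau> (entries (replicate n a) V) = kappa \<tau> (\<Sum>l\<in>V. replicate n 1 ! (l - 1)) a"
      by (simp add: kappa_def e[OF V])
  qed
  also have "\<dots> = nc_moment (\<lambda>k. kappa \<tau> k a) (replicate n 1)"
    using NC_sum_eq_nc_moment[of "\<lambda>k. kappa \<tau> k a" "replicate n 1"] by simp
  finally show ?thesis .
qed

end

section \<open>Schwinger-Dyson equations from freeness\<close>

text \<open>The pairing of \<open>f \<otimes> g\<close> with the free difference quotient of \<open>w\<close> in the letter \<open>i\<close>.\<close>

definition star :: "'b \<Rightarrow> ('b list \<Rightarrow> complex) \<Rightarrow> ('b list \<Rightarrow> complex) \<Rightarrow> 'b list \<Rightarrow> complex" where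
  "star i f g w = split_sum (\<lambda>u c v. if c = i then f u * g v else 0) w"

lemma star_Nil [simp]: "star i f g [] = 0"
  and star_Cons [simp]: "star i f g (c # w) = (if c = i then f [] * g w else 0) + star i (\<lambda>u. f (c # u)) g w"
  by (simp_all add: star_def)

lemma star_cong [fundef_cong]:
  assumes "i = i'" "f = f'" "w = w'" "\<And>v. length v < length w' \<Longrightarrow> g v = g' v"
  shows "star i f g w = star i' f' g' w'"
  unfolding star_def using assms by (intro split_sum_cong) auto

lemma star_append:
  "star i f g (u @ w) = star i f (\<lambda>v. g (v @ w)) u + star i (\<lambda>v. f (u @ v)) g w"
  by (induction u arbitrary: f) simp_all

lemma star_diff_left: "star i (\<lambda>u. f u - c * f' u) g w = star i f g w - c * star i f' g w"
  by (induction w arbitrary: f f') (simp_all add: algebra_simps)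

lemma star_diff_right: "star i f (\<lambda>u. g u - c * g' u) w = star i f g w - c * star i f g' w"
  by (induction w arbitrary: f) (simp_all add: algebra_simps)

lemma star_replicate:
  "star i f g (replicate n i) = (\<Sum>j<n. f (replicate j i) * g (replicate (n - Suc j) i))"
  by (simp add: star_def split_sum_replicate)

lemma star_replicate_other: "j \<noteq> i \<Longrightarrow> star i f g (replicate n j) = 0"
  by (simp add: star_def split_sum_replicate)

text \<open>The moment of \<open>w\<close> preceded by a block of \<open>k\<close> letters \<open>i\<close>, which may absorb further letters \<open>i\<close> of \<open>w\<close>.\<close>

function open_moment :: "(nat \<Rightarrow> complex) \<Rightarrow> ('b list \<Rightarrow> complex) \<Rightarrow> 'b \<Rightarrow> nat \<Rightarrow> 'b list \<Rightarrow> complex" where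
  "open_moment \<kappa> f i k w = \<kappa> k * f w + star i f (\<lambda>v. open_moment \<kappa> f i (Suc k) v) w"
  by pat_completeness auto
termination
  by (relation "Wellfounded.measure (\<lambda>(\<kappa>, f, i, k, w). length w)") auto

declare open_moment.simps [simp del]

text \<open>The linear extension of \<open>D\<close> evaluated at \<open>u \<cdot> \<Prod>\<^bsub>(i,k)\<^esub> (i\<^sup>k - \<mu>(i,k))\<close>.\<close>

primrec centred :: "('b \<times> nat \<Rightarrow> complex) \<Rightarrow> ('b list \<Rightarrow> complex) \<Rightarrow> 'b list \<Rightarrow> ('b \<times> nat) list \<Rightarrow> complex" where
  "centred \<mu> D u [] = D u"
| "centred \<mu> D u (p # r) = centred \<mu> D (u @ replicate (snd p) (fst p)) r - \<mu> p * centred \<mu> D u r"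

lemma centred_add: "centred \<mu> (\<lambda>w. D w + D' w) u r = centred \<mu> D u r + centred \<mu> D' u r"
  by (induction r arbitrary: u) (simp_all add: algebra_simps)

lemma centred_mult: "centred \<mu> (\<lambda>w. c * D w) u r = c * centred \<mu> D u r"
  by (induction r arbitrary: u) (simp_all add: algebra_simps)

lemma centred_diff: "centred \<mu> (\<lambda>w. D w - D' w) u r = centred \<mu> D u r - centred \<mu> D' u r"
  using centred_add[of \<mu> "\<lambda>w. D w - D' w" D' u r] by simp

abbreviation word_of :: "('b \<times> nat) list \<Rightarrow> 'b list" where
  "word_of r \<equiv> concat (map (\<lambda>p. replicate (snd p) (fst p)) r)"

text \<open>The derivation rule for products of centred powers. Constants have difference quotient
  zero, so the factor that is cut enters as a plain power; factors to its left go to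
  \<open>f\<close>, those to its right to \<open>g\<close>.\<close>

lemma centred_leibniz:
  "centred \<mu> (star i f g) u r = star i f (\<lambda>v. centred \<mu> g v r) u +
    (\<Sum>j<length r. star i (\<lambda>v. centred \<mu> (\<lambda>w. f (w @ v)) u (take j r))
      (\<lambda>v. centred \<mu> g v (drop (Suc j) r)) (replicate (snd (r ! j)) (fst (r ! j))))"
proof (induction r arbitrary: u)
  case (Cons p r)
  let ?p = "replicate (snd p) (fst p)"
  show ?case
    unfolding centred.simps Cons.IH length_Cons sum.lessThan_Suc_shift
    by (simp add: star_append star_diff_left star_diff_right sum_distrib_left algebra_simps sum_subtractf
        del: sum.lessThan_Suc)
qed simp

lemma centred_zero_short:
  assumes "\<And>w. length w < n \<Longrightarrow> D w = 0" and "length u + length (word_of r) < n"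
  shows "centred \<mu> D u r = 0"
  using assms(2) by (induction r arbitrary: u) (simp_all add: assms(1))

text \<open>Expanding the product gives the full word and strictly shorter words, since every
  omitted factor has a positive exponent; \<open>D\<close> kills the latter.\<close>

lemma centred_eq_top:
  assumes "\<And>w. length w < n \<Longrightarrow> D w = 0" and "length u + length (word_of r) \<le> n"
    and "\<forall>p\<in>set r. 0 < snd p"
  shows "centred \<mu> D u r = D (u @ word_of r)"
  using assms(2,3)
proof (induction r arbitrary: u)
  case (Cons p r)
  have "centred \<mu> D u r = 0"
    by (rule centred_zero_short[of n]) (use assms(1) Cons.prems in auto)
  then show ?case using Cons by simp
qed simp

lemma alternating_factorization:
  "\<exists>r. w = word_of r \<and> distinct_adj (map fst r) \<and> (\<forall>p\<in>set r. 0 < snd p)"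
proof (induction w)
  case Nil
  show ?case by (intro exI[of _ "[]"]) simp
next
  case (Cons c w)
  then obtain r where r: "w = word_of r" "distinct_adj (map fst r)" "\<forall>p\<in>set r. 0 < snd p" by blast
  show ?case
  proof (cases "r \<noteq> [] \<and> fst (hd r) = c")
    case True
    then obtain k r' where "r = (c, k) # r'" by (cases r) auto
    then show ?thesis using r by (intro exI[of _ "(c, Suc k) # r'"]) auto
  next
    case False
    then show ?thesis using r by (intro exI[of _ "(c, 1) # r"]) (cases r; auto)
  qed
qed

text \<open>The products of centred powers, together with the empty product, span all words.\<close>

lemma zero_if_centred_zero:
  assumes "\<And>r. distinct_adj (map fst r) \<Longrightarrow> centred \<mu> D [] r = 0"
  shows "D w = 0"
proof (induction "length w" arbitrary: w rule: less_induct)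
  case less
  obtain r where r: "w = word_of r" "distinct_adj (map fst r)" "\<forall>p\<in>set r. 0 < snd p"
    using alternating_factorization by blast
  have "centred \<mu> D [] r = D ([] @ word_of r)"
    by (rule centred_eq_top[of "length w"]) (use less r in auto)
  then show ?case using assms r by simp
qed

section \<open>Moments of a free family\<close>

context faithful_tracial_state
begin

lemma minus_scaleC: "- a = (- 1) *\<^sub>C a"
  using scaleR_scaleC[of "-1" a] by simp

lemma tau_minus: "\<tau> (- a) = - \<tau> a"
  by (simp add: minus_scaleC scaleC)

lemma tau_diff: "\<tau> (a - b) = \<tau> a - \<tau> b"
  using add[of a "- b"] by (simp add: tau_minus)

end

locale free_family = faithful_tracial_state \<tau> for \<tau> :: "'a::unital_cstar_algebra \<Rightarrow> complex" +
  fixes e :: "'i \<Rightarrow> 'a"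
  assumes free: "free_subalgebras \<tau> UNIV (\<lambda>i. unital_subalgebra_gen {e i})"
begin

abbreviation ev :: "'i list \<Rightarrow> 'a" where "ev w \<equiv> prod_list (map e w)"
abbreviation \<phi> :: "'i list \<Rightarrow> complex" where "\<phi> w \<equiv> \<tau> (ev w)"
abbreviation \<mu> :: "'i \<times> nat \<Rightarrow> complex" where "\<mu> p \<equiv> \<tau> (e (fst p) ^ snd p)"

definition centred_power :: "'i \<times> nat \<Rightarrow> 'a" where
  "centred_power p = e (fst p) ^ snd p + (- \<mu> p) *\<^sub>C 1"

lemma tau_centred_power: "\<tau> (centred_power p) = 0"
  by (simp add: centred_power_def add scaleC unital)

lemma power_in_gen: "a ^ n \<in> unital_subalgebra_gen {a}"
  by (induction n) (auto intro: unital_subalgebra_gen.intros)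

lemma centred_power_in_gen: "centred_power p \<in> unital_subalgebra_gen {e (fst p)}"
  by (auto simp: centred_power_def intro!: unital_subalgebra_gen.add unital_subalgebra_gen.scaleC
      unital_subalgebra_gen.one power_in_gen)

lemma tau_alternating:
  assumes "r \<noteq> []" "distinct_adj (map fst r)"
  shows "\<tau> (prod_list (map centred_power r)) = 0"
proof -
  let ?w = "map (\<lambda>p. (fst p, centred_power p)) r"
  have "?w \<noteq> [] \<longrightarrow> (\<forall>(i, a)\<in>set ?w. i \<in> UNIV \<and> a \<in> unital_subalgebra_gen {e i} \<and> \<tau> a = 0) \<longrightarrow>
       distinct_adj (map fst ?w) \<longrightarrow> \<tau> (prod_list (map snd ?w)) = 0"
    using free unfolding free_subalgebras_def by blast
  then show ?thesis using assms by (auto simp: o_def centred_power_in_gen tau_centred_power)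
qed

lemma tau_mult_centred_power: "\<tau> (A * centred_power p * B) = \<tau> (A * e (fst p) ^ snd p * B) - \<mu> p * \<tau> (A * B)"
  by (simp add: centred_power_def distrib_left distrib_right add scaleC mult_scaleC_left mult_scaleC_right)

text \<open>Splitting the leading power into its centred part and a constant leaves two alternating
  products of centred elements, and freeness kills both.\<close>

lemma tau_power_left:
  assumes "r \<noteq> []" "distinct_adj (map fst r)" "fst (hd r) \<noteq> i"
  shows "\<tau> (e i ^ b * prod_list (map centred_power r)) = 0"
proof -
  have "distinct_adj (map fst ((i, b) # r))" using assms by (cases r) auto
  then show ?thesis
    using tau_mult_centred_power[of 1 "(i, b)" "prod_list (map centred_power r)"] tau_alternating[of r]
      tau_alternating[of "(i, b) # r"] assms by simp
qed

lemma tau_power_both: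
  assumes "r \<noteq> []" "distinct_adj (map fst r)" "fst (hd r) \<noteq> i" "fst (last r) \<noteq> j"
  shows "\<tau> (e i ^ b * prod_list (map centred_power r) * e j ^ a) = 0"
proof -
  have "distinct_adj (map fst (r @ [(j, a)]))"
    using assms by (auto simp: distinct_adj_append_iff last_map)
  then have "\<tau> (e i ^ b * prod_list (map centred_power (r @ [(j, a)]))) = 0"
    using assms by (intro tau_power_left) auto
  then show ?thesis
    using tau_mult_centred_power[of "e i ^ b * prod_list (map centred_power r)" "(j, a)" 1] tau_power_left[OF assms(1-3), of b]
    by (simp add: mult.assoc)
qed

lemma centred_moment:
  "centred \<mu> (\<lambda>w. \<phi> (w @ v)) u r = \<tau> (ev u * prod_list (map centred_power r) * ev v)"
proof (induction r arbitrary: u)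
  case (Cons p r)
  show ?case
    using Cons tau_mult_centred_power[of "ev u" p "prod_list (map centred_power r) * ev v"]
    by (simp add: prod_list_replicate mult.assoc)
qed simp

lemma ev_replicate: "ev (replicate n i) = e i ^ n"
  by (simp add: prod_list_replicate)

text \<open>All terms of the recursion vanish: the closed one by \<open>tau_power_left\<close>, cuts
  inside the initial power by induction on \<open>b\<close>, and cuts in a later power of
  \<open>i\<close> because what stands left of it is an alternating product enclosed by powers of
  \<open>i\<close>.\<close>

lemma centred_open_moment:
  assumes "r \<noteq> []" "distinct_adj (map fst r)" "fst (hd r) \<noteq> i"
  shows "centred \<mu> (open_moment \<kappa> \<phi> i k) (replicate b i) r = 0"
proof (induction b arbitrary: k rule: less_induct)
  case (less b)
  let ?g = "\<lambda>v. open_moment \<kappa> \<phi> i (Suc k) v"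
  have "centred \<mu> (open_moment \<kappa> \<phi> i k) (replicate b i) r
      = \<kappa> k * centred \<mu> \<phi> (replicate b i) r + centred \<mu> (star i \<phi> ?g) (replicate b i) r"
    by (subst open_moment.simps[abs_def]) (simp add: centred_add centred_mult)
  also have "centred \<mu> \<phi> (replicate b i) r = 0"
    using centred_moment[of "[]" "replicate b i" r] tau_power_left[OF assms] by (simp add: ev_replicate)
  also have "star i \<phi> (\<lambda>v. centred \<mu> ?g v r) (replicate b i) = 0"
    by (simp add: star_replicate less)
  then have "centred \<mu> (star i \<phi> ?g) (replicate b i) r =
     (\<Sum>j<length r. star i (\<lambda>v. centred \<mu> (\<lambda>w. \<phi> (w @ v)) (replicate b i) (take j r))
      (\<lambda>v. centred \<mu> ?g v (drop (Suc j) r)) (replicate (snd (r ! j)) (fst (r ! j))))"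
    unfolding centred_leibniz by simp
  also have "\<dots> = 0"
  proof (rule sum.neutral, rule ballI)
    fix j assume "j \<in> {..<length r}"
    then have j: "j < length r" by simp
    show "star i (\<lambda>v. centred \<mu> (\<lambda>w. \<phi> (w @ v)) (replicate b i) (take j r))
      (\<lambda>v. centred \<mu> ?g v (drop (Suc j) r)) (replicate (snd (r ! j)) (fst (r ! j))) = 0"
    proof (cases "fst (r ! j) = i")
      case False
      then show ?thesis by (rule star_replicate_other)
    next
      case True
      have j0: "j \<noteq> 0"
      proof
        assume "j = 0"
        then show False using True assms(1,3) by (simp add: hd_conv_nth)
      qed
      \<comment> \<open>Neighbours of a power of \<open>i\<close> carry another letter, so
        \<open>take j r\<close> neither begins nor ends with \<open>i\<close> and
        \<open>tau_power_both\<close> applies.\<close>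
      have "fst (r ! (j - 1)) \<noteq> i"
        using assms(2) j j0 True by (auto simp: distinct_adj_conv_nth dest!: spec[of _ "j - 1"])
      moreover have "last (take j r) = r ! (j - 1)"
        using j j0 assms(1) by (simp add: last_conv_nth min_def)
      moreover have "distinct_adj (map fst (take j r))"
        using assms(2) by (metis append_take_drop_id distinct_adj_appendD1 map_append)
      ultimately have "\<tau> (e i ^ b * prod_list (map centred_power (take j r)) * e i ^ a) = 0" for a
        using j j0 assms by (intro tau_power_both) auto
      then show ?thesis unfolding True star_replicate centred_moment by (simp add: ev_replicate)
    qed
  qed
  finally show ?case by simp
qed

lemma open_moment_replicate:
  "open_moment (\<lambda>k. kappa \<tau> k (e i)) \<phi> i k (replicate n i)
    = nc_open (\<lambda>k. kappa \<tau> k (e i)) k (replicate n 1)"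
proof (induction n arbitrary: k rule: less_induct)
  case (less n)
  show ?case
    by (subst open_moment.simps, subst nc_open.simps)
      (simp add: star_replicate split_sum_replicate less ev_replicate power_moment)
qed

text \<open>The difference \<open>?D\<close> of both sides is linear in the word, so products of
  centred powers suffice. Pure powers of \<open>i\<close> are covered by the moment-cumulant
  formula; after a power of \<open>i\<close>, an alternating product led by another letter makes
  both sides vanish separately.\<close>

lemma moment_Cons: "\<phi> (i # w) = open_moment (\<lambda>k. kappa \<tau> k (e i)) \<phi> i 1 w"
proof -
  let ?\<kappa> = "\<lambda>k. kappa \<tau> k (e i)"
  let ?g = "open_moment ?\<kappa> \<phi> i 1"
  let ?D = "\<lambda>w. \<phi> (i # w) - ?g w"
  have pow: "?D (replicate n i) = 0" for n
    using power_moment[of "e i" "Suc n"] open_moment_replicate[of i 1 n] by (simp add: ev_replicate)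
  have cphi: "centred \<mu> (\<lambda>w. \<tau> (e i * ev w)) u r = \<tau> (e i * ev u * prod_list (map centred_power r))" for u r
  proof (induction r arbitrary: u)
    case (Cons p r)
    show ?case
      using Cons tau_mult_centred_power[of "e i * ev u" p "prod_list (map centred_power r)"]
      by (simp add: prod_list_replicate mult.assoc)
  qed simp
  have out: "centred \<mu> ?D (replicate b i) r = 0"
    if "r \<noteq> []" "distinct_adj (map fst r)" "fst (hd r) \<noteq> i" for b r
    using tau_power_left[OF that, of "Suc b"] centred_open_moment[OF that]
    by (simp add: centred_diff cphi ev_replicate)
  have "centred \<mu> ?D [] r = 0" if r: "distinct_adj (map fst r)" for r
  proof (cases r)
    case Nil
    then show ?thesis using pow[of 0] by simp
  next
    case (Cons p r')
    show ?thesis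
    proof (cases "fst p = i")
      case False
      then show ?thesis using out[of r 0] r Cons by simp
    next
      case True
      \<comment> \<open>A leading centred power of \<open>i\<close> is expanded into a power minus a
        constant; what follows is empty or starts with another letter.\<close>
      show ?thesis
      proof (cases "r' = []")
        case True
        then show ?thesis using pow[of "snd p"] pow[of 0] \<open>fst p = i\<close> Cons by simp
      next
        case False
        then have "distinct_adj (map fst r')" "fst (hd r') \<noteq> i"
          using r Cons True by (cases r'; auto)+
        then show ?thesis using out[of r' "snd p"] out[of r' 0] False True Cons by simp
      qed
    qed
  qed
  then have "?D w = 0" by (rule zero_if_centred_zero)
  then show ?thesis by simp
qed

end

section \<open>Generating series over compositions\<close>

unbundle no vec_syntax
unbundle fps_syntax

section \<open>Fixed-point arguments for power series, and shifted sums\<close>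

lemma fps_mult_nth_cong_below:
  fixes u d d' :: "'a::comm_ring_1 fps"
  assumes "u $ 0 = 0" and "\<And>k. k < n \<Longrightarrow> d $ k = d' $ k"
  shows "(u * d) $ n = (u * d') $ n"
  unfolding fps_mult_nth
proof (rule sum.cong)
  fix i assume "i \<in> {0..n}"
  then show "u $ i * d $ (n - i) = u $ i * d' $ (n - i)" using assms by (cases "i = 0") auto
qed simp

text \<open>Multiplication by \<open>u\<close> raises the order, so the coefficients of all
  \<open>d k\<close> vanish simultaneously by induction on the degree. The feedback term
  \<open>B k * d 1\<close> serves systems whose coefficients depend on the solution at index
  1.\<close>

lemma fps_system_zero:
  fixes d A B :: "nat \<Rightarrow> complex fps" and u :: "complex fps"
  assumes u: "u $ 0 = 0"
    and d: "\<And>k. d k = u * (d (Suc k) + A k * d (Suc (Suc k)) + B k * d 1)"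
  shows "d k = 0"
proof -
  have "d k $ n = 0" for n k
  proof (induction n arbitrary: k rule: less_induct)
    case (less n)
    have "(u * (d (Suc k) + A k * d (Suc (Suc k)) + B k * d 1)) $ n = (u * 0) $ n"
      by (rule fps_mult_nth_cong_below[OF u]) (simp add: fps_mult_nth less)
    then show ?case by (subst d) simp
  qed
  then show ?thesis by (simp add: fps_eq_iff)
qed

text \<open>The formal sum of \<open>fps_X^b * h (m + b)\<close> over all \<open>b\<close>; degree
  \<open>n\<close> only sees \<open>b \<le> n\<close>.\<close>

definition shift_sum :: "(nat \<Rightarrow> complex fps) \<Rightarrow> nat \<Rightarrow> complex fps" where
  "shift_sum h m = Abs_fps (\<lambda>n. \<Sum>b\<le>n. h (m + b) $ (n - b))"

lemma shift_sum_rec: "shift_sum h m = h m + fps_X * shift_sum h (Suc m)"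
proof (rule fps_ext)
  fix n show "shift_sum h m $ n = (h m + fps_X * shift_sum h (Suc m)) $ n"
    by (cases n) (simp_all add: shift_sum_def sum.atMost_Suc_shift del: sum.atMost_Suc)
qed

text \<open>The one-step recursion determines the whole family, so rules for these infinite sums are
  proved by checking that recursion.\<close>

lemma shift_sum_unique:
  assumes "\<And>m. D m = h m + fps_X * D (Suc m)"
  shows "D m = shift_sum h m"
proof -
  have "D m - shift_sum h m = 0"
  proof (rule fps_system_zero[of fps_X "\<lambda>m. D m - shift_sum h m" "\<lambda>_. 0" "\<lambda>_. 0"])
    fix k show "D k - shift_sum h k = fps_X * (D (Suc k) - shift_sum h (Suc k)
        + 0 * (D (Suc (Suc k)) - shift_sum h (Suc (Suc k))) + 0 * (D 1 - shift_sum h 1))"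
      by (subst assms, subst shift_sum_rec) (simp add: algebra_simps)
  qed simp
  then show ?thesis by simp
qed

lemma shift_sum_add: "shift_sum (\<lambda>b. h b + h' b) m = shift_sum h m + shift_sum h' m"
  by (rule shift_sum_unique[symmetric], subst shift_sum_rec, subst shift_sum_rec[of h'])
    (simp add: algebra_simps)

lemma shift_sum_mult: "shift_sum (\<lambda>b. c * h b) m = c * shift_sum h m"
  by (rule shift_sum_unique[symmetric], subst shift_sum_rec) (simp add: algebra_simps)

lemma shift_sum_mult_right: "shift_sum (\<lambda>b. h b * c) m = shift_sum h m * c"
  using shift_sum_mult[of c h m] by (simp add: mult.commute)

lemma shift_sum_shift: "shift_sum (\<lambda>b. h (b + k)) m = shift_sum h (m + k)"
  by (simp add: shift_sum_def add_ac)

text \<open>Summation by parts: the weight \<open>m + b\<close> is \<open>m\<close> plus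
  \<open>b\<close> ones, and the ones collect into the tails starting at \<open>m + 1\<close>,
  \<open>m + 2\<close> and so on.\<close>

lemma shift_sum_weighted:
  "shift_sum (\<lambda>b. of_nat b * h b) m = of_nat m * shift_sum h m + fps_X * shift_sum (shift_sum h) (Suc m)"
proof (rule shift_sum_unique[symmetric])
  fix m
  have "of_nat m * shift_sum h m = of_nat m * h m + of_nat m * (fps_X * shift_sum h (Suc m))"
    by (subst shift_sum_rec) (simp add: algebra_simps)
  moreover have "shift_sum (shift_sum h) (Suc m) = shift_sum h (Suc m) + fps_X * shift_sum (shift_sum h) (Suc (Suc m))"
    by (rule shift_sum_rec)
  ultimately show "of_nat m * shift_sum h m + fps_X * shift_sum (shift_sum h) (Suc m) =
     of_nat m * h m + fps_X * (of_nat (Suc m) * shift_sum h (Suc m) + fps_X * shift_sum (shift_sum h) (Suc (Suc m)))"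
    by (simp add: algebra_simps)
qed

section \<open>Series over compositions with parts at least two\<close>

definition comps_ge2 :: "nat \<Rightarrow> nat list set" where
  "comps_ge2 n = {ns. (\<forall>b\<in>set ns. 2 \<le> b) \<and> sum_list ns = n}"

lemma comps_ge2_0 [simp]: "comps_ge2 0 = {[]}"
proof -
  have "ns = []" if "\<forall>b\<in>set ns. 2 \<le> b" "sum_list ns = 0" for ns :: "nat list"
    using that by (cases ns) auto
  then show ?thesis by (auto simp: comps_ge2_def)
qed

lemma comps_ge2_pos: "0 < n \<Longrightarrow> comps_ge2 n = (\<Union>b\<in>{2..n}. (#) b ` comps_ge2 (n - b))"
proof (intro set_eqI iffI)
  fix ns assume "0 < n" "ns \<in> comps_ge2 n"
  then show "ns \<in> (\<Union>b\<in>{2..n}. (#) b ` comps_ge2 (n - b))" 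
    by (cases ns) (auto simp: comps_ge2_def intro!: bexI[of _ "hd ns"])
qed (auto simp: comps_ge2_def)

lemma finite_comps_ge2: "finite (comps_ge2 n)"
proof (induction n rule: less_induct)
  case (less n)
  then show ?case by (cases "n = 0") (auto simp: comps_ge2_pos)
qed

lemma sum_comps_ge2: "0 < n \<Longrightarrow> (\<Sum>ns\<in>comps_ge2 n. f ns) = (\<Sum>b\<in>{2..n}. \<Sum>ns\<in>comps_ge2 (n - b). f (b # ns))"
  unfolding comps_ge2_pos by (subst sum.UNION_disjoint) (auto simp: finite_comps_ge2 sum.reindex o_def)

definition comp_fps :: "(nat list \<Rightarrow> complex) \<Rightarrow> complex fps" where
  "comp_fps f = Abs_fps (\<lambda>n. \<Sum>ns\<in>comps_ge2 n. f ns)"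

text \<open>Splits off the first part. As it is at least 2, a factor \<open>fps_X^2\<close> comes
  out and the shifted sum starts at index 2.\<close>

lemma comp_fps_rec:
  "comp_fps f = fps_const (f []) + fps_X^2 * shift_sum (\<lambda>b. comp_fps (\<lambda>ns. f (b # ns))) 2"
proof (rule fps_ext)
  fix n :: nat
  consider "n = 0" | "n = 1" | "n \<ge> 2" by linarith
  then show "comp_fps f $ n = (fps_const (f []) + fps_X^2 * shift_sum (\<lambda>b. comp_fps (\<lambda>ns. f (b # ns))) 2) $ n"
  proof cases
    case 3
    have s: "Suc (Suc (b - 2)) = b" if "2 \<le> b" for b :: nat using that by simp
    have "(\<Sum>b\<in>{2..n}. \<Sum>ns\<in>comps_ge2 (n - b). f (b # ns))
      = (\<Sum>b\<le>n - 2. \<Sum>ns\<in>comps_ge2 (n - 2 - b). f ((2 + b) # ns))"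
      by (rule sum.reindex_bij_witness[of _ "\<lambda>b. 2 + b" "\<lambda>b. b - 2"]) (use 3 in \<open>auto simp: s\<close>)
    with 3 show ?thesis by (simp add: comp_fps_def shift_sum_def sum_comps_ge2 fps_X_power_mult_nth)
  qed (simp_all add: comp_fps_def sum_comps_ge2 fps_X_power_mult_nth)
qed

lemma comp_fps_add: "comp_fps (\<lambda>ns. f ns + g ns) = comp_fps f + comp_fps g"
  by (simp add: comp_fps_def fps_eq_iff sum.distrib)

lemma comp_fps_mult: "comp_fps (\<lambda>ns. c * f ns) = fps_const c * comp_fps f"
  by (simp add: comp_fps_def fps_eq_iff sum_distrib_left)

text \<open>A composition with a marked part is a composition, a part and a composition, so the
  series multiply. Formally both sides obey the same recursion under prepending a letter to the
  argument of \<open>f\<close>, and induction on the degree compares them for all \<open>f\<close>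
  at once.\<close>

lemma comp_fps_split_sum:
  "comp_fps (split_sum (\<lambda>u b v. f u * g b v)) = comp_fps f * (fps_X^2 * shift_sum (\<lambda>b. comp_fps (g b)) 2)"
proof -
  define Y where "Y = fps_X^2 * shift_sum (\<lambda>b. comp_fps (g b)) 2"
  let ?S = "\<lambda>f. comp_fps (split_sum (\<lambda>u b v. f u * g b v))"
  have S: "?S f = fps_const (f []) * Y + fps_X^2 * shift_sum (\<lambda>b. ?S (\<lambda>u. f (b # u))) 2" for f
    by (subst comp_fps_rec)
      (simp add: comp_fps_add comp_fps_mult shift_sum_add shift_sum_mult Y_def distrib_left mult.left_commute)
  have P: "comp_fps f * Y = fps_const (f []) * Y + fps_X^2 * shift_sum (\<lambda>b. comp_fps (\<lambda>u. f (b # u)) * Y) 2" for f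
    using arg_cong[OF comp_fps_rec[of f], of "\<lambda>h. h * Y"]
    by (simp only: shift_sum_mult_right distrib_right mult.assoc)
  have "?S f $ n = (comp_fps f * Y) $ n" for n f
  proof (induction n arbitrary: f rule: less_induct)
    case (less n)
    have "(fps_X^2 * shift_sum (\<lambda>b. ?S (\<lambda>u. f (b # u))) 2) $ n
        = (fps_X^2 * shift_sum (\<lambda>b. comp_fps (\<lambda>u. f (b # u)) * Y) 2) $ n"
      by (rule fps_mult_nth_cong_below) (simp_all add: shift_sum_def less)
    then show ?case by (subst S, subst P) simp
  qed
  then show ?thesis unfolding Y_def by (simp add: fps_eq_iff)
qed

text \<open>For \<open>S\<^sub>m = comp_fps (nc_open \<kappa> m)\<close>, the series \<open>tails \<kappa> m\<close> is \<open>\<Sum>\<^sub>b t\<^sup>b S\<^bsub>m+b\<^esub>\<close>; \<open>inner\<close> and \<open>reduced_tails\<close>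
  correspond to \<open>N\<close> and \<open>q\<close> in the introduction.\<close>

definition inner :: "(nat \<Rightarrow> complex) \<Rightarrow> complex fps" where
  "inner \<kappa> = comp_fps (nc_moment \<kappa>)"

definition tails :: "(nat \<Rightarrow> complex) \<Rightarrow> nat \<Rightarrow> complex fps" where
  "tails \<kappa> = shift_sum (\<lambda>m. comp_fps (nc_open \<kappa> m))"

definition reduced_tails :: "(nat \<Rightarrow> complex) \<Rightarrow> nat \<Rightarrow> complex fps" where
  "reduced_tails \<kappa> = shift_sum (\<lambda>m. fps_const (\<kappa> m) + fps_X^2 * tails \<kappa> (m + 2))"

text \<open>\<open>fps_X * cumulant_tails \<kappa> 1\<close> is the cumulant series, starting in
  degree 1.\<close>

definition cumulant_tails :: "(nat \<Rightarrow> complex) \<Rightarrow> nat \<Rightarrow> complex fps" where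
  "cumulant_tails \<kappa> = shift_sum (\<lambda>m. fps_const (\<kappa> m))"

text \<open>The head of the list is the size of the block containing 1. The value 0 at the empty
  list keeps the series free of a constant term.\<close>

definition weighted_moment :: "(nat \<Rightarrow> complex) \<Rightarrow> nat list \<Rightarrow> complex" where
  "weighted_moment \<kappa> ns = (case ns of [] \<Rightarrow> 0 | b # _ \<Rightarrow> of_nat b * nc_moment \<kappa> ns)"

lemma inner_eq: "inner \<kappa> = 1 + fps_X^2 * tails \<kappa> 2"
  unfolding inner_def tails_def by (subst comp_fps_rec) simp

text \<open>Either the block closes, leaving the rest of the list on its own, or it goes on after a
  gap that stands on its own; this accounts for the common factor
  \<open>inner \<kappa>\<close>.\<close>

lemma comp_fps_nc_open: "comp_fps (nc_open \<kappa> m) = inner \<kappa> * (fps_const (\<kappa> m) + fps_X^2 * tails \<kappa> (m + 2))"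
proof -
  have "nc_open \<kappa> m = (\<lambda>ns. \<kappa> m * nc_moment \<kappa> ns + split_sum (\<lambda>u b v. nc_moment \<kappa> u * nc_open \<kappa> (m + b) v) ns)"
    by (rule ext) (rule nc_open.simps)
  from arg_cong[OF this, of comp_fps] have "comp_fps (nc_open \<kappa> m) = fps_const (\<kappa> m) * inner \<kappa>
     + inner \<kappa> * (fps_X^2 * shift_sum (\<lambda>b. comp_fps (nc_open \<kappa> (m + b))) 2)"
    by (simp only: comp_fps_add comp_fps_mult comp_fps_split_sum[of "nc_moment \<kappa>" "\<lambda>b. nc_open \<kappa> (m + b)"] inner_def)
  also have "shift_sum (\<lambda>b. comp_fps (nc_open \<kappa> (m + b))) 2 = tails \<kappa> (m + 2)"
    using shift_sum_shift[of "\<lambda>m. comp_fps (nc_open \<kappa> m)" m 2] by (simp only: tails_def add.commute)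
  finally show ?thesis by (simp add: algebra_simps)
qed

lemma tails_eq: "tails \<kappa> m = inner \<kappa> * reduced_tails \<kappa> m"
proof -
  have "tails \<kappa> m = shift_sum (\<lambda>m. inner \<kappa> * (fps_const (\<kappa> m) + fps_X^2 * tails \<kappa> (m + 2))) m"
    by (subst tails_def) (simp only: comp_fps_nc_open)
  then show ?thesis by (simp only: shift_sum_mult reduced_tails_def)
qed

lemma reduced_tails_rec:
  "reduced_tails \<kappa> m = fps_const (\<kappa> m) + fps_X^2 * tails \<kappa> (m + 2) + fps_X * reduced_tails \<kappa> (Suc m)"
  unfolding reduced_tails_def by (subst shift_sum_rec) simp

lemma cumulant_tails_rec:
  "cumulant_tails \<kappa> m = fps_const (\<kappa> m) + fps_X * cumulant_tails \<kappa> (Suc m)"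
  unfolding cumulant_tails_def by (rule shift_sum_rec)

text \<open>Here the factor \<open>|V_1|\<close> is absorbed: by \<open>shift_sum_weighted\<close>
  it yields twice a tail plus tails of tails, and the latter make up the difference between
  \<open>reduced_tails\<close> and \<open>cumulant_tails\<close>.\<close>

lemma comp_fps_weighted_moment:
  "fps_X * cumulant_tails \<kappa> 1 + comp_fps (weighted_moment \<kappa>)
    = fps_X * reduced_tails \<kappa> 1 + 2 * fps_X^2 * tails \<kappa> 2"
proof -
  let ?h = "\<lambda>b. comp_fps (nc_open \<kappa> b)"
  have "comp_fps (weighted_moment \<kappa>) = fps_X^2 * shift_sum (\<lambda>b. of_nat b * ?h b) 2"
    by (subst comp_fps_rec) (simp add: weighted_moment_def comp_fps_mult fps_of_nat)
  also have "\<dots> = fps_X^2 * (2 * tails \<kappa> 2 + fps_X * shift_sum (tails \<kappa>) 3)"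
    by (simp add: shift_sum_weighted tails_def numeral_3_eq_3)
  finally have w: "comp_fps (weighted_moment \<kappa>) = \<dots>" .
  have "reduced_tails \<kappa> 1 = cumulant_tails \<kappa> 1 + fps_X^2 * shift_sum (\<lambda>m. tails \<kappa> (m + 2)) 1"
    unfolding reduced_tails_def cumulant_tails_def by (simp add: shift_sum_add shift_sum_mult)
  also have "shift_sum (\<lambda>m. tails \<kappa> (m + 2)) 1 = shift_sum (tails \<kappa>) 3"
    using shift_sum_shift[of "tails \<kappa>" 2 1] by (simp add: numeral_3_eq_3)
  finally show ?thesis unfolding w by (simp add: algebra_simps power2_eq_square)
qed

section \<open>The transfer system\<close>

lemma fps_compose_right_cancel:
  fixes f g u :: "complex fps"
  assumes "u $ 0 = 0" "u $ 1 \<noteq> 0" "f oo u = g oo u"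
  shows "f = g"
proof -
  have i0: "fps_inv u $ 0 = 0" by (simp add: fps_inv_def)
  have "h oo u oo fps_inv u = h" for h :: "complex fps"
    using fps_compose_assoc[OF i0 assms(1), of h] fps_inv_right[OF assms(1,2)] by simp
  then show ?thesis using assms(3) by metis
qed

text \<open>The series \<open>S k\<close> of the open sums and
  \<open>a * (cumulant_tails \<kappa> k oo (fps_X * a))\<close> satisfy the same recursion in
  \<open>k\<close>, so they agree; \<open>S 1\<close> yields the moments, since a non-empty list
  opens a block of weight 1.\<close>

lemma moment_cumulant_fps:
  fixes a :: "complex fps"
  assumes a: "a = Abs_fps (\<lambda>n. nc_moment \<kappa> (replicate n 1))"
  shows "a = 1 + ((fps_X * cumulant_tails \<kappa> 1) oo (fps_X * a))"
proof -
  define S where "S k = Abs_fps (\<lambda>n. nc_open \<kappa> k (replicate n 1))" for k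
  let ?u = "fps_X * a"
  have S: "S k = fps_const (\<kappa> k) * a + ?u * S (Suc k)" for k
  proof (rule fps_ext)
    fix n
    have "S k $ n = \<kappa> k * nc_moment \<kappa> (replicate n 1)
        + (\<Sum>j<n. nc_moment \<kappa> (replicate j 1) * nc_open \<kappa> (Suc k) (replicate (n - Suc j) 1))"
      unfolding S_def by (simp add: nc_open.simps[of \<kappa> k] split_sum_replicate)
    also have "(\<Sum>j<n. nc_moment \<kappa> (replicate j 1) * nc_open \<kappa> (Suc k) (replicate (n - Suc j) 1)) = (?u * S (Suc k)) $ n"
    proof (cases n)
      case (Suc m)
      have "(?u * S (Suc k)) $ n = (a * S (Suc k)) $ m" by (simp add: Suc mult.assoc)
      then show ?thesis
        by (simp add: Suc fps_mult_nth S_def a atLeast0AtMost lessThan_Suc_atMost)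
    qed simp
    finally show "S k $ n = (fps_const (\<kappa> k) * a + ?u * S (Suc k)) $ n" by (simp add: a)
  qed
  have K: "cumulant_tails \<kappa> k oo ?u = fps_const (\<kappa> k) + ?u * (cumulant_tails \<kappa> (Suc k) oo ?u)" for k
    by (subst cumulant_tails_rec) (simp add: fps_compose_add_distrib fps_compose_mult_distrib)
  have "S k - a * (cumulant_tails \<kappa> k oo ?u) = 0" for k
  proof (rule fps_system_zero[where u = ?u and A = "\<lambda>_. 0" and B = "\<lambda>_. 0"
        and d = "\<lambda>k. S k - a * (cumulant_tails \<kappa> k oo ?u)"])
    fix k show "S k - a * (cumulant_tails \<kappa> k oo ?u) = ?u * (S (Suc k) - a * (cumulant_tails \<kappa> (Suc k) oo ?u)
      + 0 * (S (Suc (Suc k)) - a * (cumulant_tails \<kappa> (Suc (Suc k)) oo ?u)) + 0 * (S 1 - a * (cumulant_tails \<kappa> 1 oo ?u)))"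
      by (subst S, subst K) (simp add: algebra_simps)
  qed simp
  then have S1: "S 1 = a * (cumulant_tails \<kappa> 1 oo ?u)" by simp
  have "a = 1 + fps_X * S 1"
  proof (rule fps_ext)
    fix n show "a $ n = (1 + fps_X * S 1) $ n" by (cases n) (simp_all add: a S_def)
  qed
  then show ?thesis unfolding S1 by (simp add: fps_compose_mult_distrib mult.assoc)
qed

text \<open>In the application \<open>P\<close>, \<open>Q\<close>, \<open>R\<close>,
  \<open>T\<close> are the series of open moments of powers of \<open>z\<close> with
  \<open>s\<close> attached at no end, on the left, on the right and at both ends. Eliminating
  \<open>T\<close> gives a recursion for \<open>R\<close>, eliminating \<open>Q\<close> one for
  \<open>P\<close>; both are matched with the combinatorial series composed with
  \<open>u\<close>.\<close>

lemma transfer_system_solution: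
  fixes a d :: "complex fps" and P Q R T :: "nat \<Rightarrow> complex fps"
  defines "u \<equiv> fps_X * a" and "I \<equiv> fps_const \<i>"
  assumes P: "\<And>k. P k = fps_const (\<kappa> k) * a + fps_X * (a * P (Suc k) + I * a * Q (Suc k))"
    and Q: "\<And>k. Q k = - (I * fps_X * d * P (Suc k))"
    and R: "\<And>k. R k = fps_X * (a * R (Suc k) + I * a * T (Suc k))"
    and T: "\<And>k. T k = fps_const (\<kappa> k) * d - I * fps_X * d * R (Suc k)"
    and d: "d = a - I * fps_X * a * R 1"
    and a: "a = 1 + fps_X * (P 1 + I * Q 1 - I * R 1)"
  shows "a = 1 + ((fps_X * cumulant_tails \<kappa> 1 + comp_fps (weighted_moment \<kappa>)) oo u)"
proof -
  have u0: "u $ 0 = 0" by (simp add: u_def)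
  have II: "I * I = -1"
    by (simp add: I_def flip: fps_const_neg)
  have II': "I * (I * z) = - z" for z
    using II by (metis mult.assoc mult_minus1)
  define N where "N = 1 - I * fps_X * R 1"
  have dN: "d = a * N" by (subst d) (simp add: N_def algebra_simps)
  define x where "x k = tails \<kappa> k oo u" for k
  define q where "q k = reduced_tails \<kappa> k oo u" for k
  define N' where "N' = inner \<kappa> oo u"
  note comp = fps_compose_add_distrib fps_compose_mult_distrib[OF u0] fps_compose_power[OF u0, symmetric]
  have N'_eq: "N' = 1 + u^2 * x 2"
    unfolding N'_def x_def by (subst inner_eq) (simp add: comp u0)
  have xq: "x k = N' * q k" for k
    unfolding N'_def x_def q_def by (subst tails_eq) (simp add: comp)
  have q_rec: "q k = fps_const (\<kappa> k) + u^2 * x (k + 2) + u * q (Suc k)" for k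
    unfolding x_def q_def by (subst reduced_tails_rec) (simp add: comp u0)
  have x_rec: "x k = N' * fps_const (\<kappa> k) + u^2 * N' * x (k + 2) + u * x (Suc k)" for k
    unfolding xq[of k] by (subst q_rec) (simp add: xq[of "Suc k"] algebra_simps)
  define r where "r k = - I * R k" for k
  have r_rec: "r k = u * r (Suc k) + u^2 * N * r (Suc (Suc k)) + u * fps_const (\<kappa> (Suc k)) * a * N" for k
  proof -
    have "r k = fps_X * (a * r (Suc k) + a * T (Suc k))"
      unfolding r_def by (subst R) (simp add: algebra_simps II')
    also have "T (Suc k) = fps_const (\<kappa> (Suc k)) * d + fps_X * d * r (Suc (Suc k))"
      unfolding r_def by (subst T) (simp add: algebra_simps)
    finally show ?thesis by (simp add: dN u_def algebra_simps power2_eq_square)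
  qed
  \<comment> \<open>\<open>y\<close> is the expected value of \<open>r\<close>: its recursion is
    that of \<open>r\<close> with \<open>N'\<close> in place of \<open>N\<close>.\<close>
  define y where "y k = u * a * x (Suc k)" for k
  have y_rec: "y k = u * y (Suc k) + u^2 * N' * y (Suc (Suc k)) + u * fps_const (\<kappa> (Suc k)) * a * N'" for k
    unfolding y_def by (subst x_rec) (simp add: algebra_simps)
  have NN': "N - N' = fps_X * (r 1 - y 1)"
    unfolding N'_eq N_def r_def y_def u_def by (simp add: algebra_simps power2_eq_square numeral_2_eq_2)
  have ry: "r k - y k = 0" for k
  \<comment> \<open>The two recursions differ in their coefficients \<open>N\<close> and
    \<open>N'\<close>, but by \<open>NN'\<close> this difference is governed by index 1 alone and
    becomes the feedback term \<open>B\<close>.\<close>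
  proof (rule fps_system_zero[OF u0, where d = "\<lambda>k. r k - y k" and A = "\<lambda>k. u * N"
        and B = "\<lambda>k. fps_X * (u * y (Suc (Suc k)) + fps_const (\<kappa> (Suc k)) * a)"])
    fix k
    have "r k - y k = u * (r (Suc k) - y (Suc k)) + u^2 * N * (r (Suc (Suc k)) - y (Suc (Suc k)))
        + (N - N') * (u^2 * y (Suc (Suc k)) + u * fps_const (\<kappa> (Suc k)) * a)"
      by (subst r_rec, subst y_rec) (simp add: algebra_simps)
    then show "r k - y k = u * (r (Suc k) - y (Suc k) + u * N * (r (Suc (Suc k)) - y (Suc (Suc k)))
        + fps_X * (u * y (Suc (Suc k)) + fps_const (\<kappa> (Suc k)) * a) * (r 1 - y 1))"
      unfolding NN' by (simp add: algebra_simps power2_eq_square)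
  qed
  then have r1: "r 1 = u * a * x 2" and NeqN': "N = N'"
    using ry[of 1] NN' by (simp_all add: y_def numeral_2_eq_2)
  have P_rec: "P k = fps_const (\<kappa> k) * a + u * P (Suc k) + u^2 * N' * P (Suc (Suc k))" for k
    by (subst P, subst Q) (simp add: dN NeqN' u_def algebra_simps II' power2_eq_square)
  have "P k - a * q k = 0" for k
  proof (rule fps_system_zero[OF u0, where d = "\<lambda>k. P k - a * q k" and A = "\<lambda>k. u * N'" and B = "\<lambda>k. 0"])
    fix k show "P k - a * q k = u * (P (Suc k) - a * q (Suc k) + u * N' * (P (Suc (Suc k)) - a * q (Suc (Suc k)))
       + 0 * (P 1 - a * q 1))"
      by (subst P_rec, subst q_rec) (simp add: xq algebra_simps power2_eq_square)
  qed
  then have Pq: "P k = a * q k" for k by simp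
  have IQ: "I * Q 1 = u * a * x 2"
    by (subst Q) (simp add: dN NeqN' Pq xq u_def algebra_simps II' numeral_2_eq_2)
  have "a = 1 + fps_X * (a * q 1 + 2 * (u * a * x 2))"
  proof -
    have "P 1 + I * Q 1 - I * R 1 = a * q 1 + u * a * x 2 + r 1"
      unfolding IQ Pq r_def by simp
    also have "\<dots> = a * q 1 + 2 * (u * a * x 2)" unfolding r1 by (simp only: mult_2 add.assoc)
    finally have eq: "P 1 + I * Q 1 - I * R 1 = \<dots>" .
    show ?thesis by (rule trans[OF a]) (simp only: eq)
  qed
  also have "\<dots> = 1 + (u * q 1 + 2 * u^2 * x 2)"
    by (simp add: u_def algebra_simps power2_eq_square)
  also have "\<dots> = 1 + ((fps_X * reduced_tails \<kappa> 1 + 2 * fps_X^2 * tails \<kappa> 2) oo u)"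
    unfolding q_def x_def by (simp add: comp u0 mult.assoc flip: fps_numeral_fps_const)
  finally show ?thesis unfolding comp_fps_weighted_moment .
qed

section \<open>Words expanding the powers of x + i[x,s]\<close>

locale free_semicircular_pair = free_family \<tau> e for \<tau> :: "'a::unital_cstar_algebra \<Rightarrow> complex" and e :: "bool \<Rightarrow> 'a" +
  assumes kappa_one: "kappa \<tau> 1 (e False) = 0"
    and kappa_two: "kappa \<tau> 2 (e False) = 1"
    and kappa_ge3: "k \<ge> 3 \<Longrightarrow> kappa \<tau> k (e False) = 0"
begin

text \<open>\<open>e True\<close> plays the role of \<open>x\<close> and \<open>e False\<close> that
  of \<open>s\<close>.\<close>

definition z :: 'a where "z = e True + \<i> *\<^sub>C (e True * e False - e False * e True)"

text \<open>\<open>z_eval f n\<close> is the linear extension of \<open>f\<close> evaluated at the expansion of \<open>z\<^sup>n\<close> into words.\<close>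

primrec z_eval :: "(bool list \<Rightarrow> complex) \<Rightarrow> nat \<Rightarrow> complex" where
  "z_eval f 0 = f []"
| "z_eval f (Suc n) = z_eval (\<lambda>w. f (True # w)) n + \<i> * z_eval (\<lambda>w. f (True # False # w)) n
    - \<i> * z_eval (\<lambda>w. f (False # True # w)) n"

definition z_fps :: "(bool list \<Rightarrow> complex) \<Rightarrow> complex fps" where "z_fps f = Abs_fps (z_eval f)"

abbreviation I :: "complex fps" where "I \<equiv> fps_const \<i>"

lemma z_fps_rec: "z_fps f = fps_const (f []) + fps_X * (z_fps (\<lambda>w. f (True # w)) + I * z_fps (\<lambda>w. f (True # False # w))
    - I * z_fps (\<lambda>w. f (False # True # w)))"
proof (rule fps_ext)
  fix n show "z_fps f $ n = (fps_const (f []) + fps_X * (z_fps (\<lambda>w. f (True # w)) + I * z_fps (\<lambda>w. f (True # False # w))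
    - I * z_fps (\<lambda>w. f (False # True # w)))) $ n"
    by (cases n) (simp_all add: z_fps_def)
qed

lemma z_eval_add: "z_eval (\<lambda>w. f w + g w) n = z_eval f n + z_eval g n"
  by (induction n arbitrary: f g) (simp_all add: algebra_simps)

lemma z_eval_mult: "z_eval (\<lambda>w. c * f w) n = c * z_eval f n"
  by (induction n arbitrary: f) (simp_all add: algebra_simps)

lemma z_fps_add: "z_fps (\<lambda>w. f w + g w) = z_fps f + z_fps g"
  by (simp add: z_fps_def fps_eq_iff z_eval_add)

lemma z_fps_mult: "z_fps (\<lambda>w. c * f w) = fps_const c * z_fps f"
  by (simp add: z_fps_def fps_eq_iff z_eval_mult)

lemma tau_mult_z: "\<tau> (A * z * B) = \<tau> (A * e True * B) + \<i> * \<tau> (A * e True * e False * B)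
    - \<i> * \<tau> (A * e False * e True * B)"
  by (simp add: z_def distrib_left distrib_right add scaleC mult_scaleC_left mult_scaleC_right
      tau_diff left_diff_distrib right_diff_distrib mult.assoc)

lemma z_eval_moment: "z_eval (\<lambda>w. \<tau> (A * ev w)) n = \<tau> (A * z ^ n)"
proof (induction n arbitrary: A)
  case (Suc n)
  show ?case
    using Suc[of "A * e True"] Suc[of "A * e True * e False"] Suc[of "A * e False * e True"]
      tau_mult_z[of A "z ^ n"]
    by (simp add: mult.assoc)
qed simp

text \<open>Coefficient \<open>Suc n\<close> of \<open>F f\<close> involves only coefficients
  \<open>n\<close> of \<open>F\<close> at modified functionals, so an induction ranging over all
  \<open>f\<close> determines \<open>F\<close>.\<close>

lemma z_fps_recursion_unique:
  assumes "\<And>f. F f = G f + fps_X * (F (\<lambda>w. f (True # w)) + I * F (\<lambda>w. f (True # False # w))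
      - I * F (\<lambda>w. f (False # True # w)))"
    and "\<And>f. F' f = G f + fps_X * (F' (\<lambda>w. f (True # w)) + I * F' (\<lambda>w. f (True # False # w))
      - I * F' (\<lambda>w. f (False # True # w)))"
  shows "F f = F' f"
proof -
  have "F f $ n = F' f $ n" for n f
  proof (induction n arbitrary: f)
    case 0
    show ?case by (subst assms(1), subst assms(2)) simp
  next
    case (Suc n)
    show ?case by (subst assms(1), subst assms(2)) (simp add: Suc)
  qed
  then show ?thesis by (simp add: fps_eq_iff)
qed

text \<open>The difference quotient of \<open>z\<close> in the letter \<open>x\<close> is 1
  \<otimes> 1 + i (1 \<otimes> s - s \<otimes> 1), and the derivation rule spreads it over the
  powers of \<open>z\<close>.\<close>

lemma z_fps_star_True: "z_fps (star True f g) = fps_X * (z_fps f * z_fps g + I * z_fps f * z_fps (\<lambda>v. g (False # v))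
    - I * z_fps (\<lambda>u. f (u @ [False])) * z_fps g)"
proof (rule z_fps_recursion_unique[where F = "\<lambda>f. z_fps (star True f g)"
      and F' = "\<lambda>f. fps_X * (z_fps f * z_fps g + I * z_fps f * z_fps (\<lambda>v. g (False # v)) - I * z_fps (\<lambda>u. f (u @ [False])) * z_fps g)"
      and G = "\<lambda>f. fps_X * (fps_const (f []) * z_fps g + I * fps_const (f []) * z_fps (\<lambda>v. g (False # v))
         - I * fps_const (f [False]) * z_fps g)"])
  fix f
  show "z_fps (star True f g) = fps_X * (fps_const (f []) * z_fps g + I * fps_const (f []) * z_fps (\<lambda>v. g (False # v))
         - I * fps_const (f [False]) * z_fps g) + fps_X * (z_fps (star True (\<lambda>w. f (True # w)) g)
         + I * z_fps (star True (\<lambda>w. f (True # False # w)) g) - I * z_fps (star True (\<lambda>w. f (False # True # w)) g))"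
    by (subst z_fps_rec) (simp add: z_fps_add z_fps_mult del: fps_const_mult, algebra)
  have "z_fps f = fps_const (f []) + fps_X * (z_fps (\<lambda>w. f (True # w)) + I * z_fps (\<lambda>w. f (True # False # w))
    - I * z_fps (\<lambda>w. f (False # True # w)))"
    by (rule z_fps_rec)
  moreover have "z_fps (\<lambda>u. f (u @ [False])) = fps_const (f [False]) + fps_X * (z_fps (\<lambda>w. f (True # w @ [False]))
     + I * z_fps (\<lambda>w. f (True # False # w @ [False])) - I * z_fps (\<lambda>w. f (False # True # w @ [False])))"
    by (subst z_fps_rec) simp
  ultimately show "fps_X * (z_fps f * z_fps g + I * z_fps f * z_fps (\<lambda>v. g (False # v)) - I * z_fps (\<lambda>u. f (u @ [False])) * z_fps g)
    = fps_X * (fps_const (f []) * z_fps g + I * fps_const (f []) * z_fps (\<lambda>v. g (False # v))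
         - I * fps_const (f [False]) * z_fps g) +
      fps_X * (fps_X * (z_fps (\<lambda>w. f (True # w)) * z_fps g + I * z_fps (\<lambda>w. f (True # w)) * z_fps (\<lambda>v. g (False # v))
         - I * z_fps (\<lambda>u. f (True # u @ [False])) * z_fps g)
      + I * (fps_X * (z_fps (\<lambda>w. f (True # False # w)) * z_fps g + I * z_fps (\<lambda>w. f (True # False # w)) * z_fps (\<lambda>v. g (False # v))
         - I * z_fps (\<lambda>u. f (True # False # u @ [False])) * z_fps g))
      - I * (fps_X * (z_fps (\<lambda>w. f (False # True # w)) * z_fps g + I * z_fps (\<lambda>w. f (False # True # w)) * z_fps (\<lambda>v. g (False # v))
         - I * z_fps (\<lambda>u. f (False # True # u @ [False])) * z_fps g)))"
    by algebra
qed

text \<open>In the letter \<open>s\<close> the difference quotient of \<open>z\<close> is i (x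
  \<otimes> 1 - 1 \<otimes> x).\<close>

lemma z_fps_star_False: "z_fps (star False f g) = fps_X * (I * z_fps (\<lambda>u. f (u @ [True])) * z_fps g - I * z_fps f * z_fps (\<lambda>v. g (True # v)))"
proof (rule z_fps_recursion_unique[where F = "\<lambda>f. z_fps (star False f g)"
      and F' = "\<lambda>f. fps_X * (I * z_fps (\<lambda>u. f (u @ [True])) * z_fps g - I * z_fps f * z_fps (\<lambda>v. g (True # v)))"
      and G = "\<lambda>f. fps_X * (I * fps_const (f [True]) * z_fps g - I * fps_const (f []) * z_fps (\<lambda>v. g (True # v)))"])
  fix f
  show "z_fps (star False f g) = fps_X * (I * fps_const (f [True]) * z_fps g - I * fps_const (f []) * z_fps (\<lambda>v. g (True # v)))
      + fps_X * (z_fps (star False (\<lambda>w. f (True # w)) g)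
         + I * z_fps (star False (\<lambda>w. f (True # False # w)) g) - I * z_fps (star False (\<lambda>w. f (False # True # w)) g))"
    by (subst z_fps_rec) (simp add: z_fps_add z_fps_mult del: fps_const_mult, algebra)
  have "z_fps f = fps_const (f []) + fps_X * (z_fps (\<lambda>w. f (True # w)) + I * z_fps (\<lambda>w. f (True # False # w))
    - I * z_fps (\<lambda>w. f (False # True # w)))"
    by (rule z_fps_rec)
  moreover have "z_fps (\<lambda>u. f (u @ [True])) = fps_const (f [True]) + fps_X * (z_fps (\<lambda>w. f (True # w @ [True]))
     + I * z_fps (\<lambda>w. f (True # False # w @ [True])) - I * z_fps (\<lambda>w. f (False # True # w @ [True])))"
    by (subst z_fps_rec) simp
  ultimately show "fps_X * (I * z_fps (\<lambda>u. f (u @ [True])) * z_fps g - I * z_fps f * z_fps (\<lambda>v. g (True # v)))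
    = fps_X * (I * fps_const (f [True]) * z_fps g - I * fps_const (f []) * z_fps (\<lambda>v. g (True # v))) +
      fps_X * (fps_X * (I * z_fps (\<lambda>u. f (True # u @ [True])) * z_fps g - I * z_fps (\<lambda>w. f (True # w)) * z_fps (\<lambda>v. g (True # v)))
      + I * (fps_X * (I * z_fps (\<lambda>u. f (True # False # u @ [True])) * z_fps g - I * z_fps (\<lambda>w. f (True # False # w)) * z_fps (\<lambda>v. g (True # v))))
      - I * (fps_X * (I * z_fps (\<lambda>u. f (False # True # u @ [True])) * z_fps g - I * z_fps (\<lambda>w. f (False # True # w)) * z_fps (\<lambda>v. g (True # v)))))"
    by algebra
qed

lemma moment_rotate: "\<phi> (u @ v) = \<phi> (v @ u)"
  by (simp add: tracial)

text \<open>Absorbing letters only raises the order of the cumulant, and all orders from 3 on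
  vanish.\<close>

lemma open_moment_semicircle_ge3:
  "k \<ge> 3 \<Longrightarrow> open_moment (\<lambda>k. kappa \<tau> k (e False)) \<phi> False k w = 0"
proof (induction "length w" arbitrary: k w rule: less_induct)
  case less
  have "star False \<phi> (\<lambda>v. open_moment (\<lambda>k. kappa \<tau> k (e False)) \<phi> False (Suc k) v) w = star False \<phi> (\<lambda>_. 0) w"
    by (rule star_cong) (use less in auto)
  also have "\<dots> = 0" using star_diff_right[of False \<phi> "\<lambda>_. 0" 1 "\<lambda>_. 0" w] by simp
  finally show ?case using less by (subst open_moment.simps) (simp add: kappa_ge3)
qed

text \<open>The Schwinger-Dyson equation: a semicircular element is its own conjugate variable.\<close>

lemma moment_semicircle: "\<phi> (False # w) = star False \<phi> \<phi> w"
proof -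
  let ?o = "open_moment (\<lambda>k. kappa \<tau> k (e False)) \<phi> False"
  have z: "star False \<phi> (\<lambda>_. 0) w = 0" for w
    using star_diff_right[of False \<phi> "\<lambda>_. 0" 1 "\<lambda>_. 0" w] by simp
  have three: "?o 3 = (\<lambda>_. 0)" by (rule ext) (simp add: open_moment_semicircle_ge3)
  have two: "?o 2 = \<phi>"
    \<comment> \<open>Unit variance makes the factor in front of \<open>\<phi>\<close> equal to
      1.\<close>
    by (rule ext, subst open_moment.simps) (simp add: kappa_two three z)
  have "?o 1 w = star False \<phi> \<phi> w"
    by (subst open_moment.simps) (use kappa_one two in \<open>simp add: numeral_2_eq_2\<close>)
  then show ?thesis using moment_Cons[of False w] by simp
qed

lemma star_snoc: "star i f g (w @ [c]) = star i f (\<lambda>v. g (v @ [c])) w + (if c = i then f w * g [] else 0)"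
  by (simp add: star_append)

lemma moment_fps_eq:
  defines "\<kappa> \<equiv> \<lambda>k. kappa \<tau> k (e True)" and "a \<equiv> Abs_fps (\<lambda>n. \<tau> (z ^ n))"
  shows "a = 1 + ((fps_X * cumulant_tails \<kappa> 1 + comp_fps (weighted_moment \<kappa>)) oo (fps_X * a))"
proof -
  let ?o = "open_moment \<kappa> \<phi> True"
  have a: "a = z_fps \<phi>"
    using z_eval_moment[of 1] by (simp add: a_def z_fps_def fps_eq_iff)
  define d where "d = z_fps (\<lambda>w. \<phi> (False # w @ [False]))"
  have oT: "\<phi> (True # w) = ?o 1 w" for w
    unfolding \<kappa>_def by (rule moment_Cons)
  have rot1: "z_fps (\<lambda>w. \<phi> (w @ [c])) = z_fps (\<lambda>w. \<phi> (c # w))" for c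
    using moment_rotate[of _ "[c]"] by simp
  \<comment> \<open>The two terms of \<open>z_fps_star_False\<close> cancel, because traciality
    moves \<open>x\<close> from the end of a word to its front.\<close>
  have b: "z_fps (\<lambda>w. \<phi> (False # w)) = 0"
  proof -
    have "z_fps (\<lambda>w. \<phi> (False # w)) = z_fps (star False \<phi> \<phi>)"
      by (simp only: moment_semicircle)
    also have "\<dots> = 0" unfolding z_fps_star_False rot1 by (simp only: mult.commute mult.left_commute) simp
    finally show ?thesis .
  qed
  have b': "z_fps (\<lambda>w. \<phi> (w @ [False])) = 0" unfolding rot1 by (rule b)
  note os = open_moment.simps[of \<kappa> \<phi> True]
  have osn: "?o k (w @ [False]) = \<kappa> k * \<phi> (w @ [False]) + star True \<phi> (\<lambda>v. ?o (Suc k) (v @ [False])) w" for k w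
    by (subst os) (simp only: star_snoc, simp)
  have oC: "?o k (False # w) = \<kappa> k * \<phi> (False # w) + star True (\<lambda>u. \<phi> (False # u)) (\<lambda>v. ?o (Suc k) v) w" for k w
    by (subst os) simp
  have oCs: "?o k (False # w @ [False]) = \<kappa> k * \<phi> (False # w @ [False])
      + star True (\<lambda>u. \<phi> (False # u)) (\<lambda>v. ?o (Suc k) (v @ [False])) w" for k w
    by (subst oC) (simp only: star_snoc, simp)
  show ?thesis
  proof (rule transfer_system_solution[where d = d and P = "\<lambda>k. z_fps (?o k)" and Q = "\<lambda>k. z_fps (\<lambda>w. ?o k (False # w))"
        and R = "\<lambda>k. z_fps (\<lambda>w. ?o k (w @ [False]))" and T = "\<lambda>k. z_fps (\<lambda>w. ?o k (False # w @ [False]))"])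
    fix k
    have "z_fps (?o k) = z_fps (\<lambda>w. \<kappa> k * \<phi> w + star True \<phi> (?o (Suc k)) w)"
      by (rule arg_cong[of _ _ z_fps]) (rule ext, rule os)
    then show "z_fps (?o k) = fps_const (\<kappa> k) * a + fps_X * (a * z_fps (?o (Suc k)) + I * a * z_fps (\<lambda>w. ?o (Suc k) (False # w)))"
      by (simp only: z_fps_add z_fps_mult z_fps_star_True b' a mult_zero_right mult_zero_left diff_zero)
    have "z_fps (\<lambda>w. ?o k (False # w)) = z_fps (\<lambda>w. \<kappa> k * \<phi> (False # w) + star True (\<lambda>u. \<phi> (False # u)) (?o (Suc k)) w)"
      by (rule arg_cong[of _ _ z_fps]) (rule ext, rule oC)
    then show "z_fps (\<lambda>w. ?o k (False # w)) = - (I * fps_X * d * z_fps (?o (Suc k)))"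
      by (simp only: z_fps_add z_fps_mult z_fps_star_True b append_Cons flip: d_def) (simp add: algebra_simps)
    have "z_fps (\<lambda>w. ?o k (w @ [False])) = z_fps (\<lambda>w. \<kappa> k * \<phi> (w @ [False]) + star True \<phi> (\<lambda>v. ?o (Suc k) (v @ [False])) w)"
      by (rule arg_cong[of _ _ z_fps]) (rule ext, rule osn)
    then show "z_fps (\<lambda>w. ?o k (w @ [False])) = fps_X * (a * z_fps (\<lambda>w. ?o (Suc k) (w @ [False]))
        + I * a * z_fps (\<lambda>w. ?o (Suc k) (False # w @ [False])))"
      by (simp only: z_fps_add z_fps_mult z_fps_star_True b' append_Cons a) simp
    have "z_fps (\<lambda>w. ?o k (False # w @ [False])) = z_fps (\<lambda>w. \<kappa> k * \<phi> (False # w @ [False])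
        + star True (\<lambda>u. \<phi> (False # u)) (\<lambda>v. ?o (Suc k) (v @ [False])) w)"
      by (rule arg_cong[of _ _ z_fps]) (rule ext, rule oCs)
    then show "z_fps (\<lambda>w. ?o k (False # w @ [False])) = fps_const (\<kappa> k) * d - I * fps_X * d * z_fps (\<lambda>w. ?o (Suc k) (w @ [False]))"
      by (simp only: z_fps_add z_fps_mult z_fps_star_True b append_Cons flip: d_def) (simp add: algebra_simps)
  next
    \<comment> \<open>The summand \<open>\<phi> w\<close> pairs the leading \<open>s\<close> with
      the trailing one, with \<open>\<phi> [] = 1\<close>.\<close>
    have "d = z_fps (\<lambda>w. star False \<phi> (\<lambda>v. \<phi> (v @ [False])) w + \<phi> w)"
      unfolding d_def by (simp only: moment_semicircle star_snoc) (simp add: unital)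
    also have "\<dots> = a - I * fps_X * a * z_fps (\<lambda>w. \<phi> (True # w @ [False]))"
      by (simp only: z_fps_add z_fps_star_False b' a append_Cons) (simp add: algebra_simps)
    finally show "d = a - I * fps_X * a * z_fps (\<lambda>w. ?o 1 (w @ [False]))" by (simp only: oT)
    \<comment> \<open>Traciality moves the leading \<open>s\<close> to the end, so that the word
      starts with \<open>x\<close> and \<open>oT\<close> applies.\<close>
    have rot: "\<phi> (False # True # w) = \<phi> (True # w @ [False])" for w
      using moment_rotate[of "[False]" "True # w"] by simp
    have "a = 1 + fps_X * (z_fps (\<lambda>w. \<phi> (True # w)) + I * z_fps (\<lambda>w. \<phi> (True # False # w)) - I * z_fps (\<lambda>w. \<phi> (False # True # w)))"
      unfolding a by (subst z_fps_rec) (simp add: unital)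
    then show "a = 1 + fps_X * (z_fps (?o 1) + I * z_fps (\<lambda>w. ?o 1 (False # w)) - I * z_fps (\<lambda>w. ?o 1 (w @ [False])))"
      by (simp only: rot oT)
  qed
qed

text \<open>The cumulant series of \<open>z\<close> and the series of the right-hand side solve the
  fixed-point equation for the same \<open>a\<close>. Composition with \<open>fps_X * a\<close> can
  be cancelled because its linear coefficient is \<open>\<tau> 1 = 1\<close>.\<close>

lemma kappa_z:
  assumes "n \<ge> 1"
  shows "kappa \<tau> n z = kappa \<tau> n (e True) + (\<Sum>ns\<in>comps_ge2 n. weighted_moment (\<lambda>k. kappa \<tau> k (e True)) ns)"
proof -
  let ?\<kappa> = "\<lambda>k. kappa \<tau> k (e True)" and ?\<kappa>z = "\<lambda>k. kappa \<tau> k z"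
  let ?a = "Abs_fps (\<lambda>n. \<tau> (z ^ n))"
  have "?a = 1 + ((fps_X * cumulant_tails ?\<kappa>z 1) oo (fps_X * ?a))"
    by (rule moment_cumulant_fps) (simp only: power_moment)
  from trans[OF sym[OF this] moment_fps_eq] have "(fps_X * cumulant_tails ?\<kappa>z 1) oo (fps_X * ?a)
      = (fps_X * cumulant_tails ?\<kappa> 1 + comp_fps (weighted_moment ?\<kappa>)) oo (fps_X * ?a)"
    by (simp only: add_left_cancel)
  then have "fps_X * cumulant_tails ?\<kappa>z 1 = fps_X * cumulant_tails ?\<kappa> 1 + comp_fps (weighted_moment ?\<kappa>)"
    by (rule fps_compose_right_cancel[rotated 2]) (simp_all add: unital)
  then have "(fps_X * cumulant_tails ?\<kappa>z 1) $ n = (fps_X * cumulant_tails ?\<kappa> 1 + comp_fps (weighted_moment ?\<kappa>)) $ n"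
    by simp
  moreover have "(fps_X * cumulant_tails \<kappa> 1) $ n = \<kappa> n" for \<kappa> :: "nat \<Rightarrow> complex"
  proof -
    obtain m where n: "n = Suc m" using assms by (cases n) auto
    have "(\<Sum>b\<le>m. fps_const (\<kappa> (1 + b)) $ (m - b)) = (\<Sum>b\<le>m. if b = m then \<kappa> (1 + b) else 0)"
      by (rule sum.cong) auto
    then show ?thesis by (simp add: n cumulant_tails_def shift_sum_def)
  qed
  ultimately show ?thesis by (simp add: comp_fps_def)
qed

end

section \<open>Interval partitions and compositions\<close>

primrec interval_blocks :: "nat \<Rightarrow> nat list \<Rightarrow> nat set list" where
  "interval_blocks m [] = []"
| "interval_blocks m (b # ns) = {m..<m + b} # interval_blocks (m + b) ns"

lemma length_interval_blocks [simp]: "length (interval_blocks m ns) = length ns"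
  by (induction ns arbitrary: m) simp_all

lemma map_card_interval_blocks: "map card (interval_blocks m ns) = ns"
  by (induction ns arbitrary: m) simp_all

lemma Union_interval_blocks: "\<Union>(set (interval_blocks m ns)) = {m..<m + sum_list ns}"
  by (induction ns arbitrary: m) (auto simp: add.assoc)

lemma interval_blocks_block: "V \<in> set (interval_blocks m ns) \<Longrightarrow> \<exists>a b. V = {a..<a + b} \<and> b \<in> set ns \<and> m \<le> a"
proof (induction ns arbitrary: m)
  case (Cons c ns)
  show ?case
  proof (cases "V = {m..<m + c}")
    case False
    then have "V \<in> set (interval_blocks (m + c) ns)" using Cons.prems by simp
    from Cons.IH[OF this] show ?thesis by force
  qed force
qed simp

lemma Min_interval_blocks_block: "0 < b \<Longrightarrow> Min {a..<a + b} = (a::nat)"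
  by (rule Min_eqI) auto

lemma sorted_Min_interval_blocks:
  "\<forall>b\<in>set ns. 0 < b \<Longrightarrow> sorted_wrt (<) (map Min (interval_blocks m ns))"
proof (induction ns arbitrary: m)
  case (Cons c ns)
  have "m < Min V" if V: "V \<in> set (interval_blocks (m + c) ns)" for V
  proof -
    obtain a b where ab: "V = {a..<a + b}" "b \<in> set ns" "m + c \<le> a" using interval_blocks_block[OF V] by blast
    then have "Min V = a" using Cons.prems by (simp add: Min_interval_blocks_block)
    then show ?thesis using ab Cons.prems by auto
  qed
  then show ?case using Cons by (auto simp: Min_interval_blocks_block)
qed simp

lemma interval_blocks_block_nonempty: "\<forall>b\<in>set ns. 0 < b \<Longrightarrow> V \<in> set (interval_blocks m ns) \<Longrightarrow> finite V \<and> V \<noteq> {}"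
  by (drule interval_blocks_block) auto

lemma distinct_interval_blocks: "\<forall>b\<in>set ns. 0 < b \<Longrightarrow> distinct (interval_blocks m ns)"
  using sorted_Min_interval_blocks[of ns m] by (simp add: strict_sorted_iff distinct_map)

lemma partition_interval_blocks:
  assumes "\<forall>b\<in>set ns. 0 < b"
  shows "partition_on {m..<m + sum_list ns} (set (interval_blocks m ns))"
proof -
  have "disjoint (set (interval_blocks m ns))"
  proof (induction ns arbitrary: m)
    case (Cons c ns)
    have "disjnt {m..<m + c} V" if "V \<in> set (interval_blocks (m + c) ns)" for V
      using interval_blocks_block[OF that] by (auto simp: disjnt_def)
    then show ?case
      using Cons[of "m + c"] by (auto simp: pairwise_insert disjnt_sym)
  qed simp
  moreover have "{} \<notin> set (interval_blocks m ns)" using interval_blocks_block_nonempty[OF assms] by blast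
  ultimately show ?thesis by (simp add: partition_on_def Union_interval_blocks)
qed

lemma block_of_eq:
  assumes "partition_on A \<sigma>" "V \<in> \<sigma>" "j \<in> V"
  shows "block_of \<sigma> j = V"
  unfolding block_of_def
  by (rule the_equality) (use assms in \<open>auto simp: partition_on_def dest: disjointD\<close>)

text \<open>Minima increase along \<open>interval_blocks\<close>, so sorting them recovers the order
  of the list.\<close>

lemma nth_block_interval_blocks:
  assumes "\<forall>b\<in>set ns. 0 < b" and "l \<in> {1..length ns}"
  shows "nth_block (set (interval_blocks m ns)) l = interval_blocks m ns ! (l - 1)"
proof -
  have l: "l - 1 < length (interval_blocks m ns)" using assms(2) by auto
  then have V: "interval_blocks m ns ! (l - 1) \<in> set (interval_blocks m ns)" by (rule nth_mem)
  have "sorted_list_of_set (Min ` set (interval_blocks m ns)) = map Min (interval_blocks m ns)"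
    using sorted_Min_interval_blocks[OF assms(1), of m] sorted_list_of_set.idem_if_sorted_distinct[of "map Min (interval_blocks m ns)"]
    by (simp add: strict_sorted_iff)
  then have "nth_block (set (interval_blocks m ns)) l = block_of (set (interval_blocks m ns)) (Min (interval_blocks m ns ! (l - 1)))"
    using l by (simp add: nth_block_def)
  also have "\<dots> = interval_blocks m ns ! (l - 1)"
    using interval_blocks_block_nonempty[OF assms(1) V] by (intro block_of_eq[OF partition_interval_blocks[OF assms(1)] V]) simp
  finally show ?thesis .
qed

lemma card_set_interval_blocks: "\<forall>b\<in>set ns. 0 < b \<Longrightarrow> card (set (interval_blocks m ns)) = length ns"
  by (simp add: distinct_card[OF distinct_interval_blocks])

lemma inj_on_interval_blocks: "inj_on (\<lambda>ns. set (interval_blocks m ns)) {ns. \<forall>b\<in>set ns. 0 < b}"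
proof (rule inj_onI)
  fix ns ns' assume a: "ns \<in> {ns. \<forall>b\<in>set ns. 0 < b}" "ns' \<in> {ns. \<forall>b\<in>set ns. 0 < b}"
    and e: "set (interval_blocks m ns) = set (interval_blocks m ns')"
  have len: "length ns = length ns'"
    using a arg_cong[OF e, of card] by (simp add: card_set_interval_blocks)
  have "interval_blocks m ns = interval_blocks m ns'"
  proof (rule nth_equalityI)
    fix i assume "i < length (interval_blocks m ns)"
    then show "interval_blocks m ns ! i = interval_blocks m ns' ! i"
      using nth_block_interval_blocks[of ns "Suc i" m] nth_block_interval_blocks[of ns' "Suc i" m] a e len by simp
  qed (simp add: len)
  then show "ns = ns'" using map_card_interval_blocks by metis
qed

text \<open>The block containing the least position \<open>m\<close> must start there; removing it
  leaves an interval partition of what follows.\<close>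

lemma interval_partition_is_interval_blocks:
  assumes "partition_on {m..<m + n} \<sigma>" and "\<forall>V\<in>\<sigma>. (\<exists>a b. V = {a..b}) \<and> 2 \<le> card V"
  shows "\<exists>ns\<in>comps_ge2 n. \<sigma> = set (interval_blocks m ns)"
  using assms
proof (induction n arbitrary: m \<sigma> rule: less_induct)
  case (less n)
  show ?case
  proof (cases "n = 0")
    case True
    then show ?thesis using less.prems by (simp add: partition_on_empty)
  next
    case False
    note P = less.prems(1)
    have U: "\<Union>\<sigma> = {m..<m + n}" using P by (simp add: partition_on_def)
    have "m \<in> \<Union>\<sigma>" unfolding U using False by simp
    then obtain V where V: "V \<in> \<sigma>" "m \<in> V" by blast
    then obtain a b where ab: "V = {a..b}" and c2: "2 \<le> card V" using less.prems(2) by blast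
    have sub: "V \<subseteq> {m..<m + n}" using U V by blast
    have "a \<in> V" using V ab by simp
    then have "m \<le> a" using sub by auto
    then have am: "a = m" using V ab by simp
    define k where "k = card V"
    have Vk: "V = {m..<m + k}" using ab am V by (auto simp: k_def)
    have k: "2 \<le> k" "k \<le> n"
      using c2 card_mono[OF _ sub] by (simp_all add: k_def)
    have disj: "W \<inter> V = {}" if "W \<in> \<sigma> - {V}" for W
      using that V P by (auto simp: partition_on_def dest: disjointD)
    have "\<Union>(\<sigma> - {V}) = \<Union>\<sigma> - V" using disj V by blast
    also have "\<dots> = {m + k..<m + k + (n - k)}" unfolding U Vk using k by auto
    finally have "partition_on {m + k..<m + k + (n - k)} (\<sigma> - {V})"
      using P by (auto simp: partition_on_def disjoint_def)
    then obtain ns where ns: "ns \<in> comps_ge2 (n - k)" "\<sigma> - {V} = set (interval_blocks (m + k) ns)"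
      using less.IH[of "n - k" "m + k" "\<sigma> - {V}"] less.prems(2) k False by auto
    have "\<sigma> = insert V (\<sigma> - {V})" using V by auto
    also have "\<dots> = set (interval_blocks m (k # ns))" unfolding ns(2) by (simp add: Vk)
    finally show ?thesis using ns k by (intro bexI[of _ "k # ns"]) (auto simp: comps_ge2_def)
  qed
qed

lemma bij_betw_comps_ge2: "bij_betw (\<lambda>ns. set (interval_blocks 1 ns)) (comps_ge2 n) (Int_ge2 n)"
  unfolding bij_betw_def
proof
  show "inj_on (\<lambda>ns. set (interval_blocks 1 ns)) (comps_ge2 n)"
    by (rule inj_on_subset[OF inj_on_interval_blocks]) (auto simp: comps_ge2_def)
  show "(\<lambda>ns. set (interval_blocks 1 ns)) ` comps_ge2 n = Int_ge2 n"
  proof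
    show "(\<lambda>ns. set (interval_blocks 1 ns)) ` comps_ge2 n \<subseteq> Int_ge2 n"
    proof (rule image_subsetI)
      fix ns assume ns: "ns \<in> comps_ge2 n"
      have pos: "\<forall>b\<in>set ns. 0 < b" using ns by (auto simp: comps_ge2_def)
      have "partition_on {1..n} (set (interval_blocks 1 ns))"
        using partition_interval_blocks[OF pos, of 1] ns
        by (simp add: comps_ge2_def atLeastLessThanSuc_atLeastAtMost)
      moreover have "(\<exists>a b. V = {a..b}) \<and> 2 \<le> card V" if "V \<in> set (interval_blocks 1 ns)" for V
      proof -
        from interval_blocks_block[OF that] obtain a b where ab: "V = {a..<a + b}" "b \<in> set ns" by blast
        then have "2 \<le> b" using ns by (auto simp: comps_ge2_def)
        then have "V = {a..a + b - 1}" using ab by auto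
        then show ?thesis using ab \<open>2 \<le> b\<close> by auto
      qed
      ultimately show "set (interval_blocks 1 ns) \<in> Int_ge2 n" by (simp add: Int_ge2_def)
    qed
    show "Int_ge2 n \<subseteq> (\<lambda>ns. set (interval_blocks 1 ns)) ` comps_ge2 n"
    proof
      fix \<sigma> assume "\<sigma> \<in> Int_ge2 n"
      then show "\<sigma> \<in> (\<lambda>ns. set (interval_blocks 1 ns)) ` comps_ge2 n"
        using interval_partition_is_interval_blocks[of 1 n \<sigma>] by (auto simp: Int_ge2_def atLeastLessThanSuc_atLeastAtMost)
    qed
  qed
qed

text \<open>Inflated blocks are unions of disjoint intervals, so sizes add up. The intervals being
  non-empty, different \<open>U\<close> have different images, and the product over the image
  becomes one over \<open>\<pi>\<close>.\<close>

lemma kappa_part_inflate: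
  assumes pos: "\<forall>b\<in>set ns. 0 < b" and p: "\<pi> \<in> NC (length ns)"
  shows "kappa_part \<tau> (inflate \<pi> (set (interval_blocks m ns))) x = (\<Prod>U\<in>\<pi>. kappa \<tau> (\<Sum>l\<in>U. ns ! (l - 1)) x)"
proof -
  let ?I = "\<lambda>l. interval_blocks m ns ! (l - 1)"
  have part: "partition_on {1..length ns} \<pi>" using p by (simp add: NC_def)
  have sub: "U \<subseteq> {1..length ns}" if "U \<in> \<pi>" for U using part that by (auto simp: partition_on_def)
  have mem: "?I l \<in> set (interval_blocks m ns)" if "l \<in> {1..length ns}" for l
    using that by (intro nth_mem) auto
  have disj: "l = l'" if "l \<in> {1..length ns}" "l' \<in> {1..length ns}" "c \<in> ?I l" "c \<in> ?I l'" for l l' c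
  proof -
    have "?I l = ?I l'"
      using partition_interval_blocks[OF pos, of m] mem[OF that(1)] mem[OF that(2)] that(3,4)
      by (auto simp: partition_on_def dest: disjointD)
    then have "l - 1 = l' - 1"
      using distinct_interval_blocks[OF pos, of m] that(1,2) by (subst (asm) nth_eq_iff_index_eq) auto
    then show ?thesis using that(1,2) by auto
  qed
  let ?G = "\<lambda>U. \<Union>l\<in>U. ?I l"
  have G: "(\<Union>l\<in>U. nth_block (set (interval_blocks m ns)) l) = ?G U" if "U \<in> \<pi>" for U
    using sub[OF that] nth_block_interval_blocks[OF pos] by (intro SUP_cong) auto
  have cardG: "card (?G U) = (\<Sum>l\<in>U. ns ! (l - 1))" if "U \<in> \<pi>" for U
  proof -
    note s = sub[OF that]
    have "card (?G U) = (\<Sum>l\<in>U. card (?I l))"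
    proof (rule card_UN_disjoint)
      show "finite U" using s finite_subset by blast
      show "\<forall>l\<in>U. finite (?I l)" using interval_blocks_block_nonempty[OF pos mem] s by blast
      show "\<forall>l\<in>U. \<forall>l'\<in>U. l \<noteq> l' \<longrightarrow> ?I l \<inter> ?I l' = {}" using disj s by blast
    qed
    also have "\<dots> = (\<Sum>l\<in>U. ns ! (l - 1))"
    proof (rule sum.cong)
      fix l assume "l \<in> U"
      then have l: "l - 1 < length ns" using s by fastforce
      have "card (?I l) = map card (interval_blocks m ns) ! (l - 1)" using l by simp
      then show "card (?I l) = ns ! (l - 1)" by (simp only: map_card_interval_blocks)
    qed simp
    finally show ?thesis .
  qed
  have inj: "inj_on ?G \<pi>"
  proof (rule inj_onI)
    fix U U' assume U: "U \<in> \<pi>" "U' \<in> \<pi>" and e: "?G U = ?G U'"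
    have "U \<noteq> {}" using U part by (auto simp: partition_on_def)
    then obtain l where l: "l \<in> U" by blast
    have l1: "l \<in> {1..length ns}" using sub[OF U(1)] l by blast
    then obtain c where c: "c \<in> ?I l" using interval_blocks_block_nonempty[OF pos mem] by blast
    then have "c \<in> ?G U'" using e l by blast
    then obtain l' where l': "l' \<in> U'" "c \<in> ?I l'" by blast
    then have "l' \<in> {1..length ns}" using sub[OF U(2)] by blast
    then have "l = l'" using disj[OF l1 _ c l'(2)] by blast
    then show "U = U'" using part U l l'(1) by (auto simp: partition_on_def dest: disjointD)
  qed
  have "inflate \<pi> (set (interval_blocks m ns)) = ?G ` \<pi>"
    unfolding inflate_def by (intro image_cong refl G)
  then have "kappa_part \<tau> (inflate \<pi> (set (interval_blocks m ns))) x = (\<Prod>U\<in>\<pi>. kappa \<tau> (card (?G U)) x)"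
    unfolding kappa_part_def by (simp only: prod.reindex[OF inj] o_def)
  also have "\<dots> = (\<Prod>U\<in>\<pi>. kappa \<tau> (\<Sum>l\<in>U. ns ! (l - 1)) x)"
    by (rule prod.cong) (simp_all only: cardG)
  finally show ?thesis .
qed

text \<open>Grouping by the number of blocks loses nothing: it lies in \<open>{1..n div 2}\<close>,
  as every block has at least two elements and \<open>n\<close> is positive.\<close>

lemma sum_Int_ge2:
  assumes "n \<ge> 1"
  shows "(\<Sum>k = 1..n div 2. \<Sum>\<sigma> \<in> {\<sigma> \<in> Int_ge2 n. card \<sigma> = k}. \<Sum>\<pi> \<in> NC k.
       of_nat (card (block_of \<sigma> 1)) * kappa_part \<tau> (inflate \<pi> \<sigma>) x)
    = (\<Sum>ns\<in>comps_ge2 n. weighted_moment (\<lambda>k. kappa \<tau> k x) ns)"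
proof -
  let ?h = "\<lambda>\<sigma>. \<Sum>\<pi> \<in> NC (card \<sigma>). of_nat (card (block_of \<sigma> 1)) * kappa_part \<tau> (inflate \<pi> \<sigma>) x"
  let ?i = "\<lambda>ns. set (interval_blocks 1 ns)"
  have pos: "\<forall>b\<in>set ns. 0 < b" if "ns \<in> comps_ge2 n" for ns using that by (auto simp: comps_ge2_def)
  have Int: "Int_ge2 n = ?i ` comps_ge2 n" using bij_betw_comps_ge2 by (simp add: bij_betw_def)
  have fin: "finite (Int_ge2 n)" unfolding Int by (simp add: finite_comps_ge2)
  have len: "2 * length ns \<le> sum_list ns" if "\<forall>b\<in>set ns. 2 \<le> b" for ns :: "nat list"
    using that by (induction ns) auto
  have "card (?i ns) \<in> {1..n div 2}" if "ns \<in> comps_ge2 n" for ns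
  proof -
    have "ns \<noteq> []" using that assms by (auto simp: comps_ge2_def)
    moreover have "2 * length ns \<le> n" using that len[of ns] by (auto simp: comps_ge2_def)
    ultimately show ?thesis using pos[OF that] by (simp add: card_set_interval_blocks Suc_le_eq)
  qed
  then have "card ` Int_ge2 n \<subseteq> {1..n div 2}" unfolding Int by blast
  then have "(\<Sum>k = 1..n div 2. \<Sum>\<sigma> \<in> {\<sigma> \<in> Int_ge2 n. card \<sigma> = k}. ?h \<sigma>) = sum ?h (Int_ge2 n)"
    by (intro sum.group fin) auto
  moreover have "(\<Sum>k = 1..n div 2. \<Sum>\<sigma> \<in> {\<sigma> \<in> Int_ge2 n. card \<sigma> = k}. \<Sum>\<pi> \<in> NC k.
       of_nat (card (block_of \<sigma> 1)) * kappa_part \<tau> (inflate \<pi> \<sigma>) x)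
    = (\<Sum>k = 1..n div 2. \<Sum>\<sigma> \<in> {\<sigma> \<in> Int_ge2 n. card \<sigma> = k}. ?h \<sigma>)"
    by (intro sum.cong refl) auto
  ultimately have "(\<Sum>k = 1..n div 2. \<Sum>\<sigma> \<in> {\<sigma> \<in> Int_ge2 n. card \<sigma> = k}. \<Sum>\<pi> \<in> NC k.
       of_nat (card (block_of \<sigma> 1)) * kappa_part \<tau> (inflate \<pi> \<sigma>) x) = sum ?h (Int_ge2 n)"
    by (simp only:)
  also have "sum ?h (Int_ge2 n) = (\<Sum>ns\<in>comps_ge2 n. ?h (?i ns))"
    by (rule sum.reindex_bij_betw[OF bij_betw_comps_ge2, symmetric])
  also have "\<dots> = (\<Sum>ns\<in>comps_ge2 n. weighted_moment (\<lambda>k. kappa \<tau> k x) ns)"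
  proof (rule sum.cong)
    fix ns assume ns: "ns \<in> comps_ge2 n"
    obtain b ns' where b: "ns = b # ns'" using ns assms by (cases ns) (auto simp: comps_ge2_def)
    have "block_of (?i ns) 1 = {1..<1 + b}"
      by (rule block_of_eq[OF partition_interval_blocks[OF pos[OF ns]]]) (use pos[OF ns] b in auto)
    then have c: "card (block_of (?i ns) 1) = b" by simp
    have "?h (?i ns) = of_nat b * (\<Sum>\<pi>\<in>NC (length ns). \<Prod>U\<in>\<pi>. kappa \<tau> (\<Sum>l\<in>U. ns ! (l - 1)) x)"
      unfolding c card_set_interval_blocks[OF pos[OF ns]] sum_distrib_left
      by (rule sum.cong) (simp_all only: kappa_part_inflate[OF pos[OF ns]])
    also have "\<dots> = of_nat b * nc_moment (\<lambda>k. kappa \<tau> k x) ns"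
      using NC_sum_eq_nc_moment[of "\<lambda>k. kappa \<tau> k x" ns] by simp
    finally show "?h (?i ns) = weighted_moment (\<lambda>k. kappa \<tau> k x) ns"
      by (simp add: weighted_moment_def b)
  qed simp
  finally show ?thesis by simp
qed

text \<open>The informal statement leaves the variance of \<open>s\<close> open, whereas
  \<open>normalized\<close> sets it to 1. The formula presupposes this scale: for n = 2 the
  left-hand side is \<kappa>_2(x) + 2 \<kappa>_2(s) \<kappa>_2(x), the right-hand side 3
  \<kappa>_2(x).\<close>

theorem proposition1p2:
  fixes \<tau> :: "'a::unital_cstar_algebra \<Rightarrow> complex" and x s :: 'a and n :: nat
  assumes "faithful_tracial_state \<tau>"
    and "self_adjoint x" and "self_adjoint s"
    and "free_pair \<tau> x s"
    and "semicircular \<tau> s" and normalized: "kappa \<tau> 2 s = 1"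
    and "n \<ge> 1"
  shows "kappa \<tau> n (x + \<i> *\<^sub>C (x * s - s * x)) =
    kappa \<tau> n x +
    (\<Sum>k = 1..n div 2. \<Sum>\<sigma> \<in> {\<sigma> \<in> Int_ge2 n. card \<sigma> = k}. \<Sum>\<pi> \<in> NC k.
       of_nat (card (block_of \<sigma> 1)) * kappa_part \<tau> (inflate \<pi> \<sigma>) x)"
proof -
  interpret faithful_tracial_state \<tau> by fact
  interpret free_semicircular_pair \<tau> "\<lambda>b. if b then x else s"
    by unfold_locales (use assms in \<open>simp_all add: free_pair_def semicircular_def\<close>)
  have "z = x + \<i> *\<^sub>C (x * s - s * x)" by (simp add: z_def)
  then show ?thesis using kappa_z[OF \<open>n \<ge> 1\<close>] sum_Int_ge2[OF \<open>n \<ge> 1\<close>, of \<tau> x] by simp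
qed

end
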